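(* Suppose that $\mu\in\widetilde\Omega_1$. For each $\theta,t\in\mathbb R$ and $x\in\mathbb T$, the set $\mathscr M^\theta_{t,x}$ of one-sided minimizers is nonempty, consists of piecewise-linear paths connecting $(t,x)$ and points of $\mathsf N$ (i.e. paths made of straight line segments whose endpoints lie in $\{(t,x)\}\cup\mathsf N$), and has unique minimal and maximal elements, denoted $X_{\theta,t,x,\mathrm L}$ and $X_{\theta,t,x,\mathrm R}$ respectively, under the partial order $\preccurlyeq$.
   Context: $\mathbb T=\mathbb R/\mathbb Z$; derivatives of $\mathbb T$-valued functions are real-valued (via local lifts). A set is discrete if it has no accumulation points in the ambient space. $\Omega$ is the set of purely atomic (nonnegative) measures $\mu$ on $\mathbb R\times\mathbb T$, with atoms of finite mass, such that $\mathsf N:=\operatorname{supp}\mu$ is discrete. For $\theta\in\mathbb R$, $s<t$ and $X\in H^1([s,t];\mathbb T)$ the action is $\mathcal A_{\theta,s,t}[X]=\frac12\int_s^t(X'(r)-\theta)^2\,dr-\mu(\{(r,X(r)): r\in[s,t)\})$. $\mathscr M^\theta_{s,y\mid t,x}$ is the set of $X\in H^1([s,t];\mathbb T)$ with $X(s)=y$, $X(t)=x$ that minimize $\mathcal A_{\theta,s,t}$ among all such paths. $\mathscr M^\theta_t$ is the set of $X\in H^1_{\mathrm{loc}}((-\infty,t];\mathbb T)$ with $X|_{[s,t]}\in\mathscr M^\theta_{s,X(s)\mid t,X(t)}$ for all $s<t$, and $\mathscr M^\theta_{t,x}=\{X\in\mathscr M^\theta_t: X(t)=x\}$. On $\mathscr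 M^\theta_{t,x}$ the order is: $X_1\preccurlyeq X_2$ if $\int_r^tX_1'(s)\,ds\ge\int_r^tX_2'(s)\,ds$ for all $r\le t$. $\widetilde\Omega_1$ is the set of $\mu\in\Omega$ for which there is $M=M(\mu)>0$ such that for all $t\in\mathbb R$ there are $s=s(t)\le t-M$ and $y\in\mathbb T$ with $\mathsf N\cap([s-M,s+M]\times\mathbb T)=\{(s,y)\}$ and $\mu(\{(s,y)\})>\frac1{4M}$, and moreover $s(t)$ can be chosen so that $\lim_{t\to+\infty}s(t)=+\infty$. *)

theory Defs
  imports "HOL-Analysis.Analysis"
begin

section \<open>The circle \<open>\<real>/\<int>\<close>\<close>

quotient_type circle = real / "\<lambda>a b :: real. a - b \<in> \<int>"
proof (rule equivpI)
  show "reflp (\<lambda>a b :: real. a - b \<in> \<int>)"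
    by (simp add: reflp_def)
  show "symp (\<lambda>a b :: real. a - b \<in> \<int>)"
    by (metis (no_types, lifting) Ints_minus minus_diff_eq sympI)
  show "transp (\<lambda>a b :: real. a - b \<in> \<int>)"
  proof (rule transpI)
    fix a b c :: real
    assume "a - b \<in> \<int>" "b - c \<in> \<int>"
    then have "(a - b) + (b - c) \<in> \<int>" by (rule Ints_add)
    then show "a - c \<in> \<int>" by simp
  qed
qed

lift_definition circle_proj :: "real \<Rightarrow> circle" is "\<lambda>a. a" .

text \<open>The quotient topology; \<open>\<real> \<times> \<real>/\<int>\<close> then carries the library's product topology and its
  Borel sets.\<close>

instantiation circle :: topological_space
begin

definition open_circle :: "circle set \<Rightarrow> bool"
  where "open_circle U \<longleftrightarrow> open (circle_proj -` U)"

instance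
  by standard (auto simp: open_circle_def vimage_Union)

end

section \<open>Point potentials\<close>

definition atom_of :: "'a measure \<Rightarrow> 'a set \<Rightarrow> bool"
  where "atom_of \<mu> B \<longleftrightarrow> B \<in> sets \<mu> \<and> emeasure \<mu> B > 0 \<and>
    (\<forall>C\<in>sets \<mu>. C \<subseteq> B \<longrightarrow> emeasure \<mu> C = 0 \<or> emeasure \<mu> (B - C) = 0)"

definition purely_atomic :: "'a measure \<Rightarrow> bool"
  where "purely_atomic \<mu> \<longleftrightarrow>
    (\<forall>A\<in>sets \<mu>. emeasure \<mu> A > 0 \<longrightarrow> (\<exists>B\<subseteq>A. atom_of \<mu> B))"

definition supp :: "'a::topological_space measure \<Rightarrow> 'a set"
  where "supp \<mu> = {p. \<forall>U. open U \<longrightarrow> p \<in> U \<longrightarrow> emeasure \<mu> U > 0}"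

definition Omega :: "(real \<times> circle) measure set"
  where "Omega = {\<mu>. sets \<mu> = sets borel \<and> purely_atomic \<mu> \<and>
    (\<forall>B. atom_of \<mu> B \<longrightarrow> emeasure \<mu> B < \<infinity>) \<and>
    (\<forall>p. \<not> p islimpt supp \<mu>)}"

text \<open>In \<open>Omega_tilde1\<close> the functions \<open>s\<close> and \<open>y\<close> choose, for every \<open>t\<close>, the point
  \<open>(s(t), y(t))\<close>.\<close>

definition Omega_tilde1 :: "(real \<times> circle) measure set"
  where "Omega_tilde1 = {\<mu> \<in> Omega. \<exists>M>0. \<exists>s y.
    (\<forall>t. s t \<le> t - M \<and>
         supp \<mu> \<inter> ({s t - M..s t + M} \<times> UNIV) = {(s t, y t)} \<and>
         measure \<mu> {(s t, y t)} > 1 / (4 * M)) \<and>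
    filterlim s at_top at_top}"

section \<open>Paths and action\<close>

text \<open>The derivative of a circle-valued function at \<open>r\<close> is that of any local lift that is
  differentiable at \<open>r\<close>: two such lifts differ by an integer constant near \<open>r\<close>.\<close>

definition circle_deriv :: "(real \<Rightarrow> circle) \<Rightarrow> real \<Rightarrow> real"
  where "circle_deriv X r = (THE d. \<exists>f.
    (\<forall>\<^sub>F u in nhds r. X u = circle_proj (f u)) \<and> (f has_real_derivative d) (at r))"

text \<open>\<open>H\<^sup>1([s,t])\<close> in its one-dimensional form: absolutely continuous functions (differentiable
  almost everywhere with integrable derivative, and satisfying the fundamental theorem of
  calculus) whose derivative is in \<open>L\<^sup>2\<close>.\<close>

definition H1_on :: "real \<Rightarrow> real \<Rightarrow> (real \<Rightarrow> real) \<Rightarrow> bool"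
  where "H1_on s t f \<longleftrightarrow>
    (AE r in lebesgue. r \<in> {s<..<t} \<longrightarrow> f differentiable (at r)) \<and>
    set_integrable lebesgue {s..t} (deriv f) \<and>
    set_integrable lebesgue {s..t} (\<lambda>r. (deriv f r)\<^sup>2) \<and>
    (\<forall>r\<in>{s..t}. f r = f s + (LINT u:{s..r}|lebesgue. deriv f u))"

text \<open>A path on an interval is a function that is \<open>undefined\<close> outside it, so that equality of
  paths is equality on the interval. On an interval every continuous path has a global lift.\<close>

definition H1_paths :: "real \<Rightarrow> real \<Rightarrow> (real \<Rightarrow> circle) set"
  where "H1_paths s t = {X \<in> extensional {s..t}.
    \<exists>f. H1_on s t f \<and> (\<forall>r\<in>{s..t}. X r = circle_proj (f r))}"

definition H1_loc_paths :: "real \<Rightarrow> (real \<Rightarrow> circle) set"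
  where "H1_loc_paths t = {X \<in> extensional {..t}. \<forall>s<t. restrict X {s..t} \<in> H1_paths s t}"

definition action ::
    "(real \<times> circle) measure \<Rightarrow> real \<Rightarrow> real \<Rightarrow> real \<Rightarrow> (real \<Rightarrow> circle) \<Rightarrow> real"
  where "action \<mu> \<theta> s t X =
    1/2 * (LINT r:{s..t}|lebesgue. (circle_deriv X r - \<theta>)\<^sup>2)
    - measure \<mu> ((\<lambda>r. (r, X r)) ` {s..<t})"

definition minimizers ::
    "(real \<times> circle) measure \<Rightarrow> real \<Rightarrow> real \<Rightarrow> circle \<Rightarrow> real \<Rightarrow> circle \<Rightarrow> (real \<Rightarrow> circle) set"
  where "minimizers \<mu> \<theta> s y t x = {X \<in> H1_paths s t. X s = y \<and> X t = x \<and>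
    (\<forall>Z\<in>H1_paths s t. Z s = y \<longrightarrow> Z t = x \<longrightarrow> action \<mu> \<theta> s t X \<le> action \<mu> \<theta> s t Z)}"

definition one_sided_minimizers ::
    "(real \<times> circle) measure \<Rightarrow> real \<Rightarrow> real \<Rightarrow> (real \<Rightarrow> circle) set"
  where "one_sided_minimizers \<mu> \<theta> t = {X \<in> H1_loc_paths t.
    \<forall>s<t. restrict X {s..t} \<in> minimizers \<mu> \<theta> s (X s) t (X t)}"

definition one_sided_minimizers_at ::
    "(real \<times> circle) measure \<Rightarrow> real \<Rightarrow> real \<Rightarrow> circle \<Rightarrow> (real \<Rightarrow> circle) set"
  where "one_sided_minimizers_at \<mu> \<theta> t x = {X \<in> one_sided_minimizers \<mu> \<theta> t. X t = x}"

definition path_le :: "real \<Rightarrow> (real \<Rightarrow> circle) \<Rightarrow> (real \<Rightarrow> circle) \<Rightarrow> bool"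
  where "path_le t X\<^sub>1 X\<^sub>2 \<longleftrightarrow> (\<forall>r\<le>t.
    (LINT u:{r..t}|lebesgue. circle_deriv X\<^sub>1 u) \<ge> (LINT u:{r..t}|lebesgue. circle_deriv X\<^sub>2 u))"

text \<open>A path on \<open>(-\<infinity>, t]\<close> made of straight segments, with breakpoint times
  \<open>t = \<tau>\<^sub>0 > \<tau>\<^sub>1 > \<dots> \<rightarrow> -\<infinity>\<close>, all of whose endpoints are the terminal point or points
  of \<open>N\<close>.\<close>

definition piecewise_linear_through ::
    "(real \<times> circle) set \<Rightarrow> real \<Rightarrow> (real \<Rightarrow> circle) \<Rightarrow> bool"
  where "piecewise_linear_through N t X \<longleftrightarrow> (\<exists>\<tau> :: nat \<Rightarrow> real.
    \<tau> 0 = t \<and> (\<forall>n. \<tau> (Suc n) < \<tau> n) \<and> filterlim \<tau> at_bot sequentially \<and>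
    (\<forall>n. (\<tau> (Suc n), X (\<tau> (Suc n))) \<in> N) \<and>
    (\<forall>n. \<exists>a v. \<forall>r\<in>{\<tau> (Suc n)..\<tau> n}. X r = circle_proj (a + v * r)))"

end

theory Submission
  imports Defs
begin

text \<open>
  A path \<open>X\<close> on the circle is handled through a real lift \<open>f\<close>, so that \<open>X r = circle_proj (f r)\<close>. On a
  bounded time interval only finitely many atoms matter, and the action of a lift is its kinetic
  energy minus the finite sum of the masses of the atoms that it hits.

  \<^bold>\<open>Minimizers between two points.\<close> By strict convexity a chord has strictly less kinetic energy
  than any other lift with the same endpoints. Hence a minimizer is straight between
  consecutive atoms on it (\<open>lift_minimizer_straight\<close>), and an arbitrary path can be replaced by one
  that is straight between the atoms it visits, without raising the action
  (\<open>exists_straight_competitor\<close>). A straight path is determined by its ends and the atoms it visits, and a bound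
  on the action confines a lift to a bounded region, which contains finitely many lifted atoms; so
  only finitely many straight paths compete. This yields existence, and also finiteness of the set of
  minimizers. Two minimizers with the same ends can exchange the pieces between two meetings; a
  minimizer that is minimal for the pointwise order of lifts therefore lies below all others
  (\<open>exists_extremal_lift_minimizer\<close>).

  \<^bold>\<open>Regeneration.\<close> Consider an atom of mass greater than \<open>1 / (4 M)\<close> that is alone in the time window
  of radius \<open>M\<close> around it. A minimizer missing it would be a single chord through the window. Adding a
  tent of height \<open>h\<close>, where \<open>\<bar>h\<bar> \<le> 1/2\<close> suffices to reach the atom on a circle of length one, costs
  only \<open>h\<^sup>2 / M \<le> 1 / (4 M)\<close>, less than the mass that is gained. So every minimizer whose time interval
  contains the window visits the atom (\<open>lift_minimizer_meets_atom\<close>).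

  \<^bold>\<open>One-sided minimizers.\<close> Iterating the choice of such atoms from \<open>t\<close> backwards gives a sequence of
  space-time points, with times tending to \<open>-\<infinity>\<close>, that all sufficiently long minimizers visit. At
  these points the problem decouples: the lowest minimizer from one of them to the terminal point is
  extended by the lowest minimizer from the next one. The union of these nested minimizers is a
  one-sided minimizer below all others (\<open>exists_extremal_one_sided_lift\<close>). Multiplying lifts by a
  factor \<open>\<epsilon>\<close> of either sign treats the lowest and the highest minimizer by the same argument. Since
  lifts are normalized by their value at time \<open>t\<close>, the order of paths is the pointwise order of lifts,
  and it is antisymmetric; the least and the greatest element are then the unique minimal and the
  unique maximal one.
\<close>

section \<open>The topology of the circle\<close>

lemma circle_proj_eq_iff: "circle_proj a = circle_proj b \<longleftrightarrow> a - b \<in> \<int>"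
  by transfer simp

lemma circle_proj_surj: obtains a where "x = circle_proj a"
  by (metis Quotient_abs_rep[OF Quotient_circle] circle_proj_def comp_apply id_apply map_fun_apply)

lemma circle_proj_add_Int: "k \<in> \<int> \<Longrightarrow> circle_proj (a + k) = circle_proj a"
  by (simp add: circle_proj_eq_iff)

lemma continuous_on_circle_proj: "continuous_on S circle_proj"
  by (rule continuous_on_subset[of UNIV])
     (simp_all add: continuous_on_open_vimage open_circle_def)

lemma open_circle_proj_image:
  assumes "open U" shows "open (circle_proj ` U)"
proof -
  have "circle_proj -` (circle_proj ` U) = (\<Union>k\<in>\<int>. (+) k ` U)"
  proof (intro set_eqI iffI)
    fix z assume "z \<in> circle_proj -` (circle_proj ` U)"
    then obtain u where u: "u \<in> U" "z - u \<in> \<int>" by (auto simp: circle_proj_eq_iff)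
    then have "z = (z - u) + u" by simp
    then show "z \<in> (\<Union>k\<in>\<int>. (+) k ` U)" using u by blast
  qed (auto simp: circle_proj_eq_iff intro!: rev_image_eqI)
  then show ?thesis
    using assms by (auto simp: open_circle_def intro!: open_UN open_translation)
qed

text \<open>Second countability makes the complement of the support of a measure negligible, by the Lindelof
  property.\<close>

instance circle :: second_countable_topology
proof
  obtain B :: "real set set" where B: "countable B" "topological_basis B"
    using ex_countable_basis by blast
  have "topological_basis ((`) circle_proj ` B)"
  proof (rule topological_basisI)
    fix B' assume "B' \<in> (`) circle_proj ` B"
    then show "open B'"
      using B(2) open_circle_proj_image topological_basis_open by blast
  next
    fix O' :: "circle set" and x assume O: "open O'" "x \<in> O'"
    obtain a where a: "x = circle_proj a" by (rule circle_proj_surj)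
    obtain V where "V \<in> B" "a \<in> V" "V \<subseteq> circle_proj -` O'"
      using topological_basisE[OF B(2), of "circle_proj -` O'" a] O a
      by (auto simp: open_circle_def)
    then show "\<exists>B'\<in>(`) circle_proj ` B. x \<in> B' \<and> B' \<subseteq> O'"
      using a by blast
  qed
  then show "\<exists>B::circle set set. countable B \<and> open = generate_topology B"
    using B(1) topological_basis_imp_subbasis by blast
qed

text \<open>The standard embedding into the complex plane separates points, whence the circle is Hausdorff. The
  graph of a continuous path over a compact interval is then closed, and therefore measurable.\<close>

lift_definition circle_cis :: "circle \<Rightarrow> complex" is "\<lambda>a. cis (2 * pi * a)"
proof -
  fix a b :: real assume "a - b \<in> \<int>"
  then have "cis (2 * pi * (a - b)) = 1" by (simp add: cis_multiple_2pi)
  then show "cis (2 * pi * a) = cis (2 * pi * b)"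
    by (simp add: right_diff_distrib flip: cis_divide)
qed

instance circle :: t2_space
proof
  fix x y :: circle assume "x \<noteq> y"
  obtain a b where ab: "x = circle_proj a" "y = circle_proj b"
    by (metis circle_proj_surj)
  have open_vimage: "open (circle_cis -` U)" if "open U" for U
  proof -
    have "open ((\<lambda>a. cis (2 * pi * a)) -` U)"
      unfolding cis_conv_exp by (intro continuous_open_vimage[OF that] continuous_intros)
    also have "(\<lambda>a. cis (2 * pi * a)) -` U = circle_proj -` (circle_cis -` U)"
      by (auto simp: circle_cis.abs_eq circle_proj.abs_eq)
    finally show ?thesis by (simp add: open_circle_def)
  qed
  have "circle_cis x \<noteq> circle_cis y"
  proof
    assume "circle_cis x = circle_cis y"
    then have "cis (2 * pi * a) = cis (2 * pi * b)"
      by (simp add: ab circle_cis.abs_eq circle_proj.abs_eq)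
    then obtain n :: int where "2 * pi * a = 2 * pi * b + 2 * pi * of_int n"
      using sin_cos_eq_iff[of "2 * pi * a" "2 * pi * b"] by (auto simp: complex_eq_iff mult_ac)
    then have "2 * pi * (a - b) = 2 * pi * of_int n" by (simp add: algebra_simps)
    then have "a - b = of_int n" by simp
    then show False using \<open>x \<noteq> y\<close> by (simp add: ab circle_proj_eq_iff)
  qed
  from hausdorff[OF this]
  obtain U V where "open U" "open V" "circle_cis x \<in> U" "circle_cis y \<in> V" "U \<inter> V = {}"
    by blast
  then show "\<exists>U V. open U \<and> open V \<and> x \<in> U \<and> y \<in> V \<and> U \<inter> V = {}"
    by (intro exI[of _ "circle_cis -` U"] exI[of _ "circle_cis -` V"]) (auto simp: open_vimage)
qed

lemma compact_UNIV_circle: "compact (UNIV :: circle set)"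
proof -
  have "(UNIV :: circle set) = circle_proj ` {0..1}"
  proof -
    have "x \<in> circle_proj ` {0..1}" for x
    proof -
      obtain a where "x = circle_proj a" by (rule circle_proj_surj)
      then have "x = circle_proj (frac a)"
        by (simp add: circle_proj_eq_iff frac_def)
      then show ?thesis by (metis atLeastAtMost_iff frac_ge_0 frac_lt_1 image_eqI less_imp_le)
    qed
    then show ?thesis by blast
  qed
  then show ?thesis
    using compact_continuous_image[OF continuous_on_circle_proj] by (metis compact_Icc)
qed

text \<open>The fibres of the projection are translates of the integers, so a bounded set contains finitely many
  lifts of each point.\<close>

lemma finite_bounded_lifts:
  assumes "finite Q"
  shows "finite {z. \<bar>z\<bar> \<le> B \<and> circle_proj z \<in> Q}"
proof -
  have fin: "finite {z. \<bar>z\<bar> \<le> B \<and> circle_proj z = q}" for q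
  proof -
    obtain c where q: "q = circle_proj c" by (rule circle_proj_surj)
    have "{z. \<bar>z\<bar> \<le> B \<and> circle_proj z = q} \<subseteq> (\<lambda>k. c + of_int k) ` {\<lfloor>- B - c\<rfloor>..\<lceil>B - c\<rceil>}"
    proof
      fix z assume z: "z \<in> {z. \<bar>z\<bar> \<le> B \<and> circle_proj z = q}"
      then obtain k :: int where k: "z - c = of_int k"
        by (auto simp: q circle_proj_eq_iff elim: Ints_cases)
      then have "of_int k \<le> B - c" "- B - c \<le> of_int k" using z by auto
      then have "k \<in> {\<lfloor>- B - c\<rfloor>..\<lceil>B - c\<rceil>}" by (simp, linarith)
      then show "z \<in> (\<lambda>k. c + of_int k) ` {\<lfloor>- B - c\<rfloor>..\<lceil>B - c\<rceil>}"
        using k by (intro image_eqI[of _ _ k]) auto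
    qed
    then show ?thesis by (rule finite_subset) simp
  qed
  have "{z. \<bar>z\<bar> \<le> B \<and> circle_proj z \<in> Q} = (\<Union>q\<in>Q. {z. \<bar>z\<bar> \<le> B \<and> circle_proj z = q})"
    by auto
  then show ?thesis using assms fin by simp
qed

lemma circle_proj_nearest_lift:
  obtains z where "circle_proj z = y" "\<bar>z - a\<bar> \<le> 1/2"
proof -
  obtain b where b: "y = circle_proj b" by (rule circle_proj_surj)
  show thesis
  proof (rule that)
    show "circle_proj (b + of_int (round (a - b))) = y"
      by (simp add: b circle_proj_add_Int)
    show "\<bar>b + of_int (round (a - b)) - a\<bar> \<le> 1/2"
      using of_int_round_abs_le[of "a - b"] by (simp add: algebra_simps abs_if split: if_splits)
  qed
qed

section \<open>Discrete supports and negligible sets\<close>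

lemma finite_discrete_Int_compact:
  assumes "\<And>p. \<not> p islimpt S" "compact K"
  shows "finite (S \<inter> K)"
  using Heine_Borel_imp_Bolzano_Weierstrass[OF assms(2), of "S \<inter> K"] assms(1)
  by (meson inf_le1 inf_le2 islimpt_subset)

text \<open>The open null sets cover the complement of the support, and countably many of them suffice.\<close>

lemma emeasure_disjoint_supp:
  fixes \<mu> :: "'a::second_countable_topology measure"
  assumes "sets \<mu> = sets borel" "B \<in> sets \<mu>" "B \<inter> supp \<mu> = {}"
  shows "emeasure \<mu> B = 0"
proof -
  define F where "F = {U :: 'a set. open U \<and> emeasure \<mu> U = 0}"
  obtain F' where F': "F' \<subseteq> F" "countable F'" "\<Union>F' = \<Union>F"
    using Lindelof[of F] by (auto simp: F_def)
  have "(\<Union>U\<in>F'. U) \<in> null_sets \<mu>"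
    using F'(1,2) assms(1) by (intro null_sets_UN') (auto simp: F_def null_sets_def)
  moreover have "B \<subseteq> (\<Union>U\<in>F'. U)"
  proof
    fix p assume "p \<in> B"
    then have "p \<notin> supp \<mu>" using assms(3) by auto
    then have "p \<in> \<Union>F" by (auto simp: supp_def F_def)
    then show "p \<in> (\<Union>U\<in>F'. U)" using F'(3) by simp
  qed
  ultimately have "B \<in> null_sets \<mu>"
    using assms(2) null_sets_subset by blast
  then show ?thesis by auto
qed

text \<open>Completeness of Lebesgue measure: \<open>deriv f\<close> and \<open>circle_deriv X\<close> agree with the true derivative only
  where it exists, and take unspecified values on the remaining null set.\<close>

lemma borel_measurable_lebesgue_cong_AE:
  fixes f g :: "real \<Rightarrow> real"
  assumes "f \<in> borel_measurable lebesgue" "AE x in lebesgue. f x = g x"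
  shows "g \<in> borel_measurable lebesgue"
proof (rule measurableI)
  fix A :: "real set" assume A: "A \<in> sets borel"
  have "g -` A \<in> sets lebesgue"
  proof (rule completion.in_sets_AE)
    show "AE x in lebesgue. x \<in> f -` A \<longleftrightarrow> x \<in> g -` A"
      using assms(2) by eventually_elim auto
    show "f -` A \<in> sets lebesgue"
      using measurable_sets[OF assms(1) A] by simp
  qed simp
  then show "g -` A \<inter> space lebesgue \<in> sets lebesgue" by simp
qed simp

lemma set_lebesgue_integral_lebesgue_cong_AE:
  fixes f g :: "real \<Rightarrow> real"
  assumes A: "A \<in> sets lebesgue" and f: "set_integrable lebesgue A f"
    and ae: "AE r in lebesgue. r \<in> A \<longrightarrow> f r = g r"
  shows "set_integrable lebesgue A g" "(LINT r:A|lebesgue. f r) = (LINT r:A|lebesgue. g r)"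
proof -
  let ?f = "\<lambda>r. indicator A r *\<^sub>R f r" and ?g = "\<lambda>r. indicator A r *\<^sub>R g r"
  have m: "?f \<in> borel_measurable lebesgue" using f by (auto simp: set_integrable_def)
  have e: "AE r in lebesgue. ?f r = ?g r"
    using ae by eventually_elim (auto simp: indicator_def)
  have m': "?g \<in> borel_measurable lebesgue" by (rule borel_measurable_lebesgue_cong_AE[OF m e])
  show "set_integrable lebesgue A g"
    using f integrable_cong_AE[OF m m' e] by (simp add: set_integrable_def)
  show "(LINT r:A|lebesgue. f r) = (LINT r:A|lebesgue. g r)"
    using integral_cong_AE[OF m m' e] by (simp add: set_lebesgue_integral_def)
qed

section \<open>Square-integrable derivatives on an interval\<close>

lemma AE_lebesgue_neq: "AE r in lebesgue. r \<noteq> (c::real)"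
  by (rule AE_completion[OF AE_lborel_singleton])

lemma set_integral_Icc_split:
  fixes g :: "real \<Rightarrow> real"
  assumes "set_integrable lebesgue {s..t} g" "s \<le> b" "b \<le> t"
  shows "(LINT r:{s..t}|lebesgue. g r) = (LINT r:{s..b}|lebesgue. g r) + (LINT r:{b..t}|lebesgue. g r)"
proof -
  have un: "{s..t} = {s..b} \<union> {b..t}" using assms by auto
  have "AE r in lebesgue. \<not> (r \<in> {s..b} \<and> r \<in> {b..t})"
    using AE_lebesgue_neq[of b] by eventually_elim auto
  then show ?thesis
    unfolding un using assms
    by (intro set_integral_Un_AE) (auto intro: set_integrable_subset[OF assms(1)])
qed

lemma set_integral_Icc_const:
  fixes c :: real assumes "s \<le> t"
  shows "set_integrable lebesgue {s..t} (\<lambda>r. c)"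
    and "(LINT r:{s..t}|lebesgue. c) = c * (t - s)"
proof -
  show i: "set_integrable lebesgue {s..t} (\<lambda>r. c)"
    unfolding set_integrable_def by (intro integrable_scaleR_left integrable_real_indicator) (auto simp: assms)
  show "(LINT r:{s..t}|lebesgue. c) = c * (t - s)"
    using assms by (simp add: set_lebesgue_integral_eq_integral(2)[OF i])
qed

lemma has_real_derivative_cong_Icc:
  fixes f g :: "real \<Rightarrow> real"
  assumes "\<And>u. u \<in> {s..t} \<Longrightarrow> f u = g u" "r \<in> {s<..<t}"
  shows "(f has_real_derivative d) (at r) \<longleftrightarrow> (g has_real_derivative d) (at r)"
proof (rule DERIV_cong_ev)
  show "\<forall>\<^sub>F x in nhds r. f x = g x"
    using eventually_nhds_in_open[of "{s<..<t}" r] assms by (auto elim!: eventually_mono)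
qed simp_all

lemma real_differentiable_iff:
  fixes f :: "real \<Rightarrow> real"
  shows "f differentiable (at r) \<longleftrightarrow> (\<exists>d. (f has_real_derivative d) (at r))"
  by (simp add: real_differentiable_def)

lemma deriv_cong_Icc:
  fixes f g :: "real \<Rightarrow> real"
  assumes "\<And>u. u \<in> {s..t} \<Longrightarrow> f u = g u" "r \<in> {s<..<t}"
  shows "deriv f r = deriv g r" "f differentiable (at r) \<longleftrightarrow> g differentiable (at r)"
  using has_real_derivative_cong_Icc[OF assms]
  by (simp_all add: deriv_def real_differentiable_iff)

lemma AE_deriv_cong_Icc:
  fixes f g :: "real \<Rightarrow> real"
  assumes "\<And>u. u \<in> {s..t} \<Longrightarrow> f u = g u"
  shows "AE r in lebesgue. r \<in> {s..t} \<longrightarrow> deriv f r = deriv g r"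
  using AE_lebesgue_neq[of s] AE_lebesgue_neq[of t]
  by eventually_elim (auto intro!: deriv_cong_Icc[OF assms])

lemma H1_onD:
  assumes "H1_on s t f"
  shows H1_on_differentiable: "AE r in lebesgue. r \<in> {s<..<t} \<longrightarrow> f differentiable (at r)"
    and H1_on_integrable: "set_integrable lebesgue {s..t} (deriv f)"
    and H1_on_square_integrable: "set_integrable lebesgue {s..t} (\<lambda>r. (deriv f r)\<^sup>2)"
    and H1_on_ftc: "\<And>r. r \<in> {s..t} \<Longrightarrow> f r = f s + (LINT u:{s..r}|lebesgue. deriv f u)"
  using assms unfolding H1_on_def by blast+

text \<open>Only the values on the closed interval matter: off the two endpoints the derivative is determined by
  them, although \<open>deriv f\<close> at an endpoint may depend on values outside.\<close>

lemma H1_on_cong: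
  assumes f: "H1_on s t f" and eq: "\<And>u. u \<in> {s..t} \<Longrightarrow> f u = g u"
  shows "H1_on s t g"
  unfolding H1_on_def
proof (intro conjI ballI)
  show "AE r in lebesgue. r \<in> {s<..<t} \<longrightarrow> g differentiable (at r)"
    using H1_on_differentiable[OF f]
    by eventually_elim (use deriv_cong_Icc(2)[of s t f g] eq in blast)
  show "set_integrable lebesgue {s..t} (deriv g)"
    by (rule set_lebesgue_integral_lebesgue_cong_AE(1)[OF _ H1_on_integrable[OF f]])
       (simp, rule AE_deriv_cong_Icc, rule eq)
  show "set_integrable lebesgue {s..t} (\<lambda>r. (deriv g r)\<^sup>2)"
  proof (rule set_lebesgue_integral_lebesgue_cong_AE(1)[OF _ H1_on_square_integrable[OF f]])
    show "AE r in lebesgue. r \<in> {s..t} \<longrightarrow> (deriv f r)\<^sup>2 = (deriv g r)\<^sup>2"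
      using AE_deriv_cong_Icc[of s t f g] eq by (auto elim: eventually_mono)
  qed simp
  fix r assume r: "r \<in> {s..t}"
  have "(LINT u:{s..r}|lebesgue. deriv f u) = (LINT u:{s..r}|lebesgue. deriv g u)"
  proof (rule set_lebesgue_integral_lebesgue_cong_AE(2))
    show "set_integrable lebesgue {s..r} (deriv f)"
      using r by (intro set_integrable_subset[OF H1_on_integrable[OF f]]) auto
    show "AE u in lebesgue. u \<in> {s..r} \<longrightarrow> deriv f u = deriv g u"
      using r by (intro AE_deriv_cong_Icc eq) auto
  qed simp
  then show "g r = g s + (LINT u:{s..r}|lebesgue. deriv g u)"
    using H1_on_ftc[OF f r] eq[of r] eq[of s] r by auto
qed

lemma H1_on_increment:
  assumes f: "H1_on s t f" and "s \<le> a" "a \<le> b" "b \<le> t"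
  shows "f b - f a = (LINT u:{a..b}|lebesgue. deriv f u)"
proof -
  have "(LINT u:{s..b}|lebesgue. deriv f u) =
      (LINT u:{s..a}|lebesgue. deriv f u) + (LINT u:{a..b}|lebesgue. deriv f u)"
    using assms by (intro set_integral_Icc_split set_integrable_subset[OF H1_on_integrable[OF f]]) auto
  then show ?thesis
    using H1_on_ftc[OF f, of a] H1_on_ftc[OF f, of b] assms by auto
qed

lemma H1_on_subinterval:
  assumes f: "H1_on s t f" and "s \<le> a" "b \<le> t"
  shows "H1_on a b f"
  unfolding H1_on_def
proof (intro conjI ballI)
  show "AE r in lebesgue. r \<in> {a<..<b} \<longrightarrow> f differentiable (at r)"
    using H1_on_differentiable[OF f] by eventually_elim (use assms in auto)
  show "set_integrable lebesgue {a..b} (deriv f)"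
    "set_integrable lebesgue {a..b} (\<lambda>r. (deriv f r)\<^sup>2)"
    using assms by (auto intro: set_integrable_subset[OF H1_on_integrable[OF f]]
        set_integrable_subset[OF H1_on_square_integrable[OF f]])
  show "f r = f a + (LINT u:{a..r}|lebesgue. deriv f u)" if "r \<in> {a..b}" for r
    using H1_on_increment[OF f, of a r] assms that by (simp add: algebra_simps)
qed

lemma H1_on_continuous_on:
  assumes f: "H1_on s t f" shows "continuous_on {s..t} f"
proof -
  have i: "deriv f integrable_on {s..t}"
    by (rule set_lebesgue_integral_eq_integral(1)[OF H1_on_integrable[OF f]])
  have "continuous_on {s..t} (\<lambda>r. f s + integral {s..r} (deriv f))"
    by (intro continuous_intros indefinite_integral_continuous_1[OF i])
  moreover have "f s + integral {s..r} (deriv f) = f r" if "r \<in> {s..t}" for r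
  proof -
    have "set_integrable lebesgue {s..r} (deriv f)"
      using that by (intro set_integrable_subset[OF H1_on_integrable[OF f]]) auto
    then show ?thesis
      using H1_on_ftc[OF f that] set_lebesgue_integral_eq_integral(2)[of "{s..r}" "deriv f"] by simp
  qed
  ultimately show ?thesis using continuous_on_eq by blast
qed

lemma deriv_affine: "deriv (\<lambda>r. a + v * r) r = (v::real)"
  by (rule DERIV_imp_deriv) (auto intro!: derivative_eq_intros)

lemma H1_on_affine:
  assumes "s \<le> t" shows "H1_on s t (\<lambda>r. a + v * r)"
  unfolding H1_on_def deriv_affine
  by (auto simp: set_integral_Icc_const algebra_simps assms
      intro!: AE_I2 derivative_intros)

text \<open>This holds also where \<open>f\<close> is not differentiable, because the two derivatives are choices from the
  same, possibly empty, set.\<close>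

lemma deriv_add_const: "deriv (\<lambda>r. f r + c) = deriv (f :: real \<Rightarrow> real)"
proof -
  have "((\<lambda>r. f r + c) has_real_derivative d) (at r) \<longleftrightarrow> (f has_real_derivative d) (at r)" for r d
  proof
    assume "((\<lambda>r. f r + c) has_real_derivative d) (at r)"
    from DERIV_diff[OF this DERIV_const[of c]]
    show "(f has_real_derivative d) (at r)" by simp
  qed (auto intro!: derivative_eq_intros)
  then show ?thesis by (simp add: deriv_def fun_eq_iff)
qed

lemma H1_on_add_const:
  assumes f: "H1_on s t f" shows "H1_on s t (\<lambda>r. f r + c)"
  unfolding H1_on_def deriv_add_const
proof (intro conjI ballI H1_on_integrable[OF f] H1_on_square_integrable[OF f])
  show "AE r in lebesgue. r \<in> {s<..<t} \<longrightarrow> (\<lambda>r. f r + c) differentiable (at r)"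
    using H1_on_differentiable[OF f] by eventually_elim auto
  fix r assume "r \<in> {s..t}"
  from H1_on_ftc[OF f this]
  show "f r + c = f s + c + (LINT u:{s..r}|lebesgue. deriv f u)" by linarith
qed

definition join :: "real \<Rightarrow> (real \<Rightarrow> real) \<Rightarrow> (real \<Rightarrow> real) \<Rightarrow> real \<Rightarrow> real"
  where "join b f g r = (if r \<le> b then f r else g r)"

lemma join_left [simp]: "r \<le> b \<Longrightarrow> join b f g r = f r"
  by (simp add: join_def)

lemma join_right: "f b = g b \<Longrightarrow> b \<le> r \<Longrightarrow> join b f g r = g r"
  by (auto simp: join_def)

lemma H1_on_glue:
  assumes sb: "s \<le> b" "b \<le> t" and f: "H1_on s b f" "H1_on b t f"
  shows "H1_on s t f"
  unfolding H1_on_def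
proof (intro conjI ballI)
  have un: "{s..t} = {s..b} \<union> {b..t}" using sb by auto
  show "AE r in lebesgue. r \<in> {s<..<t} \<longrightarrow> f differentiable (at r)"
    using H1_on_differentiable[OF f(1)] H1_on_differentiable[OF f(2)] AE_lebesgue_neq[of b]
    by eventually_elim (use sb in auto)
  show i: "set_integrable lebesgue {s..t} (deriv f)"
    unfolding un by (intro set_integrable_Un H1_on_integrable f) auto
  show "set_integrable lebesgue {s..t} (\<lambda>r. (deriv f r)\<^sup>2)"
    unfolding un by (intro set_integrable_Un H1_on_square_integrable f) auto
  fix r assume r: "r \<in> {s..t}"
  show "f r = f s + (LINT u:{s..r}|lebesgue. deriv f u)"
  proof (cases "r \<le> b")
    case True then show ?thesis using H1_on_ftc[OF f(1), of r] r by simp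
  next
    case False
    then have "(LINT u:{s..r}|lebesgue. deriv f u) =
        (LINT u:{s..b}|lebesgue. deriv f u) + (LINT u:{b..r}|lebesgue. deriv f u)"
      using r sb by (intro set_integral_Icc_split set_integrable_subset[OF i]) auto
    then show ?thesis
      using H1_on_ftc[OF f(1), of b] H1_on_ftc[OF f(2), of r] r sb False by simp
  qed
qed

lemma H1_on_join:
  assumes "s \<le> b" "b \<le> t" "H1_on s b f" "H1_on b t g" "f b = g b"
  shows "H1_on s t (join b f g)"
proof (rule H1_on_glue[OF assms(1,2)])
  show "H1_on s b (join b f g)"
    using assms(3) by (rule H1_on_cong) simp
  show "H1_on b t (join b f g)"
    using assms(4) by (rule H1_on_cong) (simp add: join_right[where f = f and g = g] assms(5))
qed

section \<open>Kinetic energy and chords\<close>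

definition energy :: "real \<Rightarrow> real \<Rightarrow> real \<Rightarrow> (real \<Rightarrow> real) \<Rightarrow> real"
  where "energy \<theta> s t f = 1/2 * (LINT r:{s..t}|lebesgue. (deriv f r - \<theta>)\<^sup>2)"

lemma H1_on_tilted_square_integrable:
  assumes f: "H1_on s t f"
  shows "set_integrable lebesgue {s..t} (\<lambda>r. (deriv f r - \<theta>)\<^sup>2)"
proof (cases "s \<le> t")
  case True
  have "set_integrable lebesgue {s..t} (\<lambda>r. (deriv f r)\<^sup>2 - (2 * \<theta>) * deriv f r + \<theta>\<^sup>2)"
    using set_integral_Icc_const[OF True] H1_on_integrable[OF f] H1_on_square_integrable[OF f]
    by (intro set_integral_add set_integral_diff set_integrable_mult_right) auto
  moreover have "(\<lambda>r. (deriv f r)\<^sup>2 - (2 * \<theta>) * deriv f r + \<theta>\<^sup>2) = (\<lambda>r. (deriv f r - \<theta>)\<^sup>2)"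
    by (simp add: power2_diff algebra_simps)
  ultimately show ?thesis by simp
qed simp

lemma energy_split:
  assumes "H1_on s t f" "s \<le> b" "b \<le> t"
  shows "energy \<theta> s t f = energy \<theta> s b f + energy \<theta> b t f"
  unfolding energy_def
  using set_integral_Icc_split[OF H1_on_tilted_square_integrable[OF assms(1)] assms(2,3)]
  by (simp add: algebra_simps)

lemma energy_cong:
  assumes f: "H1_on s t f" and eq: "\<And>u. u \<in> {s..t} \<Longrightarrow> f u = g u"
  shows "energy \<theta> s t f = energy \<theta> s t g"
proof -
  have "AE r in lebesgue. r \<in> {s..t} \<longrightarrow> (deriv f r - \<theta>)\<^sup>2 = (deriv g r - \<theta>)\<^sup>2"
    using AE_deriv_cong_Icc[of s t f g] eq by (auto elim: eventually_mono)
  from set_lebesgue_integral_lebesgue_cong_AE(2)[OF _ H1_on_tilted_square_integrable[OF f] this]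
  show ?thesis by (simp add: energy_def)
qed

lemma energy_add_const: "energy \<theta> s t (\<lambda>r. f r + c) = energy \<theta> s t f"
  by (simp add: energy_def deriv_add_const)

lemma energy_nonneg: "0 \<le> energy \<theta> s t f"
  by (simp add: energy_def set_lebesgue_integral_def)

lemma energy_affine:
  "s \<le> t \<Longrightarrow> energy \<theta> s t (\<lambda>r. a + v * r) = (v - \<theta>)\<^sup>2 * (t - s) / 2"
  by (simp add: energy_def deriv_affine set_integral_Icc_const)

definition chord :: "real \<Rightarrow> real \<Rightarrow> (real \<Rightarrow> real) \<Rightarrow> real \<Rightarrow> real"
  where "chord s t f r = f s + (f t - f s) / (t - s) * (r - s)"

definition chord_cost :: "real \<Rightarrow> real \<Rightarrow> real \<Rightarrow> (real \<Rightarrow> real) \<Rightarrow> real"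
  where "chord_cost \<theta> s t f = ((f t - f s) / (t - s) - \<theta>)\<^sup>2 * (t - s) / 2"

lemma chord_affine:
  "chord s t f = (\<lambda>r. (f s - (f t - f s) / (t - s) * s) + (f t - f s) / (t - s) * r)"
proof
  fix r
  have "v * (r - s) = v * r - v * s" for v :: real by (rule right_diff_distrib)
  then show "chord s t f r = (f s - (f t - f s) / (t - s) * s) + (f t - f s) / (t - s) * r"
    unfolding chord_def by (simp del: times_divide_eq_left)
qed

lemma chord_endpoints [simp]: "chord s t f s = f s" "s < t \<Longrightarrow> chord s t f t = f t"
  by (simp_all add: chord_def)

lemma H1_on_chord: "s \<le> t \<Longrightarrow> H1_on s t (chord s' t' f)"
  by (simp only: chord_affine[of s' t'] H1_on_affine)

lemma energy_chord: "s \<le> t \<Longrightarrow> energy \<theta> s t (chord s t f) = chord_cost \<theta> s t f"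
  by (simp only: chord_affine energy_affine chord_cost_def)

text \<open>The velocity of the chord is the mean of \<open>deriv f\<close>, so the deviation from it is orthogonal to
  constants. The excess of energy over the chord is thus half the squared norm of this deviation, which
  gives both the minimality of chords and their uniqueness as minimizers.\<close>

lemma energy_decompose:
  assumes f: "H1_on s t f" and "s < t"
  defines "v \<equiv> (f t - f s) / (t - s)"
  shows "energy \<theta> s t f = chord_cost \<theta> s t f + 1/2 * (LINT r:{s..t}|lebesgue. (deriv f r - v)\<^sup>2)"
proof -
  have st: "s \<le> t" using \<open>s < t\<close> by simp
  note i1 = H1_on_integrable[OF f] and i2 = H1_on_tilted_square_integrable[OF f, of v]
    and c = set_integral_Icc_const[OF st]
  have mean: "(LINT r:{s..t}|lebesgue. deriv f r - v) = 0"
    using H1_on_increment[OF f, of s t] st \<open>s < t\<close> by (simp add: set_integral_diff[OF i1 c(1)] c v_def)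
  have id: "set_integrable lebesgue {s..t} (\<lambda>r. (2 * (v - \<theta>)) * (deriv f r - v))"
    by (intro set_integrable_mult_right set_integral_diff i1 c)
  have "(LINT r:{s..t}|lebesgue. (deriv f r - \<theta>)\<^sup>2) =
      (LINT r:{s..t}|lebesgue. (deriv f r - v)\<^sup>2 + (2 * (v - \<theta>)) * (deriv f r - v) + (v - \<theta>)\<^sup>2)"
    by (simp add: power2_eq_square algebra_simps)
  also have "\<dots> = (LINT r:{s..t}|lebesgue. (deriv f r - v)\<^sup>2) +
      (2 * (v - \<theta>)) * (LINT r:{s..t}|lebesgue. deriv f r - v) + (v - \<theta>)\<^sup>2 * (t - s)"
    unfolding set_integral_add(2)[OF set_integral_add(1)[OF i2 id] c(1)]
        set_integral_add(2)[OF i2 id] c(2) set_integral_mult_right ..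
  finally show ?thesis
    by (simp add: mean energy_def chord_cost_def flip: v_def)
qed

lemma energy_ge_chord_cost:
  assumes "H1_on s t f" "s < t" shows "chord_cost \<theta> s t f \<le> energy \<theta> s t f"
  unfolding energy_decompose[OF assms] by (simp add: set_lebesgue_integral_def)

lemma energy_eq_chord_cost_imp:
  assumes f: "H1_on s t f" and "s < t" and le: "energy \<theta> s t f \<le> chord_cost \<theta> s t f"
    and r: "r \<in> {s..t}"
  shows "f r = chord s t f r"
proof -
  define v where "v = (f t - f s) / (t - s)"
  define h where "h = (\<lambda>r. indicator {s..t} r *\<^sub>R (deriv f r - v)\<^sup>2)"
  have int: "integrable lebesgue h"
    using H1_on_tilted_square_integrable[OF f, of v] by (simp add: set_integrable_def h_def)
  have "integral\<^sup>L lebesgue h \<le> 0"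
    using le unfolding energy_decompose[OF f \<open>s < t\<close>] by (simp add: v_def h_def set_lebesgue_integral_def)
  then have "integral\<^sup>L lebesgue h = 0"
    by (intro antisym) (auto simp: h_def intro!: integral_nonneg_AE)
  then have "AE r in lebesgue. h r = 0"
    using integral_nonneg_eq_0_iff_AE[OF int] by (auto simp: h_def)
  then have ae: "AE u in lebesgue. u \<in> {s..r} \<longrightarrow> deriv f u = v"
    by eventually_elim (use r in \<open>auto simp: h_def\<close>)
  have "(LINT u:{s..r}|lebesgue. deriv f u) = (LINT u:{s..r}|lebesgue. v)"
    using r ae by (intro set_lebesgue_integral_lebesgue_cong_AE(2)
        set_integrable_subset[OF H1_on_integrable[OF f]]) auto
  then show ?thesis
    using H1_on_ftc[OF f r] r by (simp add: set_integral_Icc_const chord_def flip: v_def)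
qed

text \<open>A bound on the energy controls the displacement; this confines paths of bounded action to a bounded
  region.\<close>

lemma displacement_le_energy:
  assumes "H1_on s t f" "s < t"
  shows "(f t - f s - \<theta> * (t - s))\<^sup>2 \<le> 2 * (t - s) * energy \<theta> s t f"
proof -
  have "f t - f s - \<theta> * (t - s) = ((f t - f s) / (t - s) - \<theta>) * (t - s)"
    using assms(2) by (simp add: field_simps)
  then have "(f t - f s - \<theta> * (t - s))\<^sup>2 = 2 * (t - s) * chord_cost \<theta> s t f"
    by (simp add: chord_cost_def power_mult_distrib power2_eq_square)
  then show ?thesis
    using energy_ge_chord_cost[OF assms, of \<theta>] assms(2) by (simp add: mult_left_mono)
qed

section \<open>The reward collected from the atoms\<close>

lemma graph_in_borel:
  fixes f :: "real \<Rightarrow> real"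
  assumes "continuous_on {s..t} f"
  shows "(\<lambda>r. (r, circle_proj (f r))) ` {s..<t} \<in> sets borel"
proof (cases "s < t")
  case True
  let ?G = "\<lambda>r. (r, circle_proj (f r))"
  have "continuous_on {s..t} (\<lambda>r. circle_proj (f r))"
    using continuous_on_compose2[OF continuous_on_circle_proj[of UNIV] assms] by simp
  then have "compact (?G ` {s..t})"
    by (intro compact_continuous_image continuous_intros compact_Icc)
  then have "?G ` {s..t} \<in> sets borel" by (intro borel_closed compact_imp_closed)
  moreover have "?G ` {s..<t} = ?G ` {s..t} - {?G t}"
    using True by (auto simp: less_le)
  ultimately show ?thesis by simp
qed simp

locale point_potential =
  fixes \<mu> :: "(real \<times> circle) measure"
  assumes in_Omega: "\<mu> \<in> Omega"
begin

lemma sets_borel: "sets \<mu> = sets borel"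
  using in_Omega by (simp add: Omega_def)

lemma finite_supp_strip: "finite (supp \<mu> \<inter> ({a..b} \<times> UNIV))"
  using in_Omega
  by (intro finite_discrete_Int_compact compact_Times compact_UNIV_circle) (auto simp: Omega_def)

text \<open>A point of positive mass is an atom, and atoms have finite mass.\<close>

lemma emeasure_point_finite: "emeasure \<mu> {p} \<noteq> \<infinity>"
proof (cases "emeasure \<mu> {p} = 0")
  case False
  have "{p} \<in> sets \<mu>" by (simp add: sets_borel)
  then have "atom_of \<mu> {p}"
    using False by (auto simp: atom_of_def zero_less_iff_neq_zero subset_singleton_iff)
  then show ?thesis using in_Omega by (auto simp: Omega_def)
qed simp

abbreviation mass :: "real \<Rightarrow> real \<Rightarrow> real"
  where "mass r z \<equiv> measure \<mu> {(r, circle_proj z)}"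

text \<open>As in the action, the final time is left out, so that rewards add up over adjacent intervals.\<close>

definition hits :: "real \<Rightarrow> real \<Rightarrow> (real \<Rightarrow> real) \<Rightarrow> real set"
  where "hits s t f = {r \<in> {s..<t}. (r, circle_proj (f r)) \<in> supp \<mu>}"

definition reward :: "real \<Rightarrow> real \<Rightarrow> (real \<Rightarrow> real) \<Rightarrow> real"
  where "reward s t f = (\<Sum>r\<in>hits s t f. mass r (f r))"

lemma finite_hits: "finite (hits s t f)"
proof (rule finite_subset)
  show "hits s t f \<subseteq> fst ` (supp \<mu> \<inter> ({s..t} \<times> UNIV))"
    by (auto simp: hits_def intro!: rev_image_eqI)
qed (simp add: finite_supp_strip)

text \<open>The part of the graph off the support is a null set, and the rest is a finite set of points.\<close>

lemma measure_graph:
  assumes "continuous_on {s..t} f"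
  shows "measure \<mu> ((\<lambda>r. (r, circle_proj (f r))) ` {s..<t}) = reward s t f"
proof -
  let ?G = "\<lambda>r. (r, circle_proj (f r))"
  let ?A = "?G ` {s..<t}"
  have A: "?A \<in> sets \<mu>" using graph_in_borel[OF assms] by (simp add: sets_borel)
  have At: "?A \<inter> supp \<mu> = ?G ` hits s t f" by (auto simp: hits_def)
  have fin: "finite (?A \<inter> supp \<mu>)" by (simp add: At finite_hits)
  then have As: "?A \<inter> supp \<mu> \<in> sets \<mu>"
    by (simp add: sets_borel finite_imp_closed)
  have "emeasure \<mu> (?A - (?A \<inter> supp \<mu>)) = 0"
    using A As by (intro emeasure_disjoint_supp sets_borel) auto
  then have "emeasure \<mu> ?A = emeasure \<mu> (?A \<inter> supp \<mu>)"
    using plus_emeasure[OF As, of "?A - (?A \<inter> supp \<mu>)"] A As by (auto simp: Un_Diff_cancel2 Un_absorb1)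
  then have "measure \<mu> ?A = measure \<mu> (?A \<inter> supp \<mu>)" by (simp add: measure_def)
  also have "\<dots> = (\<Sum>p\<in>?A \<inter> supp \<mu>. measure \<mu> {p})"
    using fin emeasure_point_finite by (intro measure_eq_sum_singleton) (auto simp: sets_borel)
  also have "\<dots> = reward s t f"
    unfolding At reward_def by (subst sum.reindex) (auto simp: inj_on_def)
  finally show ?thesis .
qed

lemma reward_split:
  assumes "s \<le> b" "b \<le> t"
  shows "reward s t f = reward s b f + reward b t f"
proof -
  have "hits s t f = hits s b f \<union> hits b t f" "hits s b f \<inter> hits b t f = {}"
    using assms by (auto simp: hits_def)
  then show ?thesis by (simp add: reward_def sum.union_disjoint finite_hits)
qed

lemma reward_mono:
  assumes "\<And>r. r \<in> hits s t f \<Longrightarrow> circle_proj (g r) = circle_proj (f r)"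
  shows "reward s t f \<le> reward s t g"
proof -
  have "reward s t f = (\<Sum>r\<in>hits s t f. mass r (g r))"
    using assms by (simp add: reward_def)
  also have "\<dots> \<le> reward s t g"
    unfolding reward_def using assms
    by (intro sum_mono2 finite_hits) (auto simp: hits_def)
  finally show ?thesis .
qed

lemma reward_cong:
  assumes "\<And>r. r \<in> {s..<t} \<Longrightarrow> circle_proj (f r) = circle_proj (g r)"
  shows "reward s t f = reward s t g"
  using assms by (intro antisym reward_mono) (auto simp: hits_def)

definition total_mass :: "real \<Rightarrow> real \<Rightarrow> real"
  where "total_mass s t = (\<Sum>p\<in>supp \<mu> \<inter> ({s..t} \<times> UNIV). measure \<mu> {p})"

lemma reward_le_total_mass: "reward s t f \<le> total_mass s t"
proof -
  have "reward s t f = (\<Sum>p\<in>(\<lambda>r. (r, circle_proj (f r))) ` hits s t f. measure \<mu> {p})"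
    by (subst sum.reindex) (auto simp: inj_on_def reward_def)
  also have "\<dots> \<le> total_mass s t"
    unfolding total_mass_def
    by (intro sum_mono2 finite_supp_strip) (auto simp: hits_def)
  finally show ?thesis .
qed

section \<open>Minimizing lifts between two points\<close>

definition lift_action :: "real \<Rightarrow> real \<Rightarrow> real \<Rightarrow> (real \<Rightarrow> real) \<Rightarrow> real"
  where "lift_action \<theta> s t f = energy \<theta> s t f - reward s t f"

lemma lift_action_split:
  assumes "H1_on s t f" "s \<le> b" "b \<le> t"
  shows "lift_action \<theta> s t f = lift_action \<theta> s b f + lift_action \<theta> b t f"
  by (simp add: lift_action_def energy_split[OF assms] reward_split[OF assms(2,3)])

lemma lift_action_cong:
  assumes "H1_on s t f" "\<And>r. r \<in> {s..t} \<Longrightarrow> f r = g r"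
  shows "lift_action \<theta> s t f = lift_action \<theta> s t g"
  unfolding lift_action_def
  using energy_cong[OF assms, where \<theta> = \<theta>] reward_cong[of s t f g] assms(2) by simp

lemma lift_action_add_Int:
  assumes "k \<in> \<int>"
  shows "lift_action \<theta> s t (\<lambda>r. f r + k) = lift_action \<theta> s t f"
proof -
  have "reward s t (\<lambda>r. f r + k) = reward s t f"
    using assms by (intro reward_cong) (simp add: circle_proj_add_Int)
  then show ?thesis by (simp add: lift_action_def energy_add_const)
qed

lemma lift_action_join:
  assumes "s \<le> b" "b \<le> t" "H1_on s b f" "H1_on b t g" "f b = g b"
  shows "lift_action \<theta> s t (join b f g) = lift_action \<theta> s b f + lift_action \<theta> b t g"
proof -
  have "lift_action \<theta> s b f = lift_action \<theta> s b (join b f g)"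
    by (rule lift_action_cong[OF assms(3)]) simp
  moreover have "lift_action \<theta> b t g = lift_action \<theta> b t (join b f g)"
    by (rule lift_action_cong[OF assms(4)]) (simp add: join_right[where f = f and g = g] assms(5))
  ultimately show ?thesis
    using lift_action_split[OF H1_on_join[OF assms] assms(1,2)] by simp
qed

text \<open>The competitors need to have the same endpoints only modulo integers: it is the projected path that
  has prescribed ends.\<close>

definition lift_minimizer :: "real \<Rightarrow> real \<Rightarrow> real \<Rightarrow> (real \<Rightarrow> real) \<Rightarrow> bool"
  where "lift_minimizer \<theta> s t f \<longleftrightarrow> H1_on s t f \<and>
    (\<forall>g. H1_on s t g \<longrightarrow> circle_proj (g s) = circle_proj (f s) \<longrightarrow>
      circle_proj (g t) = circle_proj (f t) \<longrightarrow> lift_action \<theta> s t f \<le> lift_action \<theta> s t g)"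

lemma lift_minimizer_H1: "lift_minimizer \<theta> s t f \<Longrightarrow> H1_on s t f"
  by (simp add: lift_minimizer_def)

lemma lift_minimizerD:
  assumes "lift_minimizer \<theta> s t f" "H1_on s t g"
    "circle_proj (g s) = circle_proj (f s)" "circle_proj (g t) = circle_proj (f t)"
  shows "lift_action \<theta> s t f \<le> lift_action \<theta> s t g"
  using assms by (simp add: lift_minimizer_def)

lemma lift_minimizer_le:
  assumes "lift_minimizer \<theta> s t f" "H1_on s t g"
    "circle_proj (g s) = circle_proj (f s)" "circle_proj (g t) = circle_proj (f t)"
    "lift_action \<theta> s t g \<le> lift_action \<theta> s t f"
  shows "lift_minimizer \<theta> s t g"
  using assms unfolding lift_minimizer_def by (metis order_trans)

lemma lift_minimizer_cong:
  assumes f: "lift_minimizer \<theta> s t f" and "s \<le> t" and eq: "\<And>r. r \<in> {s..t} \<Longrightarrow> f r = g r"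
  shows "lift_minimizer \<theta> s t g"
  using \<open>s \<le> t\<close> H1_on_cong[OF lift_minimizer_H1[OF f], of g] eq
    lift_action_cong[OF lift_minimizer_H1[OF f], of g \<theta>]
  by (intro lift_minimizer_le[OF f]) auto

text \<open>A better path on the initial interval could be continued by a translate of \<open>f\<close>; the integer \<open>k\<close>
  matches the values at the junction.\<close>

lemma lift_minimizer_prefix:
  assumes f: "lift_minimizer \<theta> s t f" and b: "s \<le> b" "b \<le> t"
  shows "lift_minimizer \<theta> s b f"
  unfolding lift_minimizer_def
proof (intro conjI allI impI)
  note H = lift_minimizer_H1[OF f]
  show "H1_on s b f" using b by (intro H1_on_subinterval[OF H]) auto
  fix g assume g: "H1_on s b g" "circle_proj (g s) = circle_proj (f s)" "circle_proj (g b) = circle_proj (f b)"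
  define k where "k = g b - f b"
  have k: "k \<in> \<int>" using g(3) by (simp add: k_def circle_proj_eq_iff)
  let ?f = "\<lambda>r. f r + k"
  have Hf: "H1_on b t ?f" using b by (intro H1_on_add_const H1_on_subinterval[OF H]) auto
  have gb: "g b = ?f b" by (simp add: k_def)
  have "lift_action \<theta> s t f \<le> lift_action \<theta> s t (join b g ?f)"
    using b g(2) k gb
    by (intro lift_minimizerD[OF f] H1_on_join b g(1) Hf)
       (auto simp: join_right[where f = g and g = ?f] circle_proj_add_Int)
  then show "lift_action \<theta> s b f \<le> lift_action \<theta> s b g"
    by (simp add: lift_action_join[OF b g(1) Hf gb] lift_action_split[OF H b] lift_action_add_Int[OF k])
qed

lemma lift_minimizer_suffix:
  assumes f: "lift_minimizer \<theta> s t f" and b: "s \<le> b" "b \<le> t"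
  shows "lift_minimizer \<theta> b t f"
  unfolding lift_minimizer_def
proof (intro conjI allI impI)
  note H = lift_minimizer_H1[OF f]
  show "H1_on b t f" using b by (intro H1_on_subinterval[OF H]) auto
  fix g assume g: "H1_on b t g" "circle_proj (g b) = circle_proj (f b)" "circle_proj (g t) = circle_proj (f t)"
  define k where "k = g b - f b"
  have k: "k \<in> \<int>" using g(2) by (simp add: k_def circle_proj_eq_iff)
  let ?f = "\<lambda>r. f r + k"
  have Hf: "H1_on s b ?f" using b by (intro H1_on_add_const H1_on_subinterval[OF H]) auto
  have gb: "?f b = g b" by (simp add: k_def)
  have "lift_action \<theta> s t f \<le> lift_action \<theta> s t (join b ?f g)"
    using b g(3) k gb
    by (intro lift_minimizerD[OF f] H1_on_join b g(1) Hf)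
       (auto simp: join_right[where f = ?f and g = g] circle_proj_add_Int)
  then show "lift_action \<theta> b t f \<le> lift_action \<theta> b t g"
    by (simp add: lift_action_join[OF b Hf g(1) gb] lift_action_split[OF H b] lift_action_add_Int[OF k])
qed

text \<open>Up to a meeting point \<open>g\<close> is optimal for the same boundary data as \<open>f\<close>, so it may replace \<open>f\<close> there.\<close>

lemma lift_minimizer_join:
  assumes f: "lift_minimizer \<theta> s t f" and g: "lift_minimizer \<theta> s t g" and b: "s \<le> b" "b \<le> t"
    and meet: "g b = f b" and s: "circle_proj (g s) = circle_proj (f s)"
  shows "lift_minimizer \<theta> s t (join b g f)"
proof (rule lift_minimizer_le[OF f])
  note Hf = lift_minimizer_H1[OF f] and Hg = lift_minimizer_H1[OF g]
  have Hgs: "H1_on s b g" and Hft: "H1_on b t f" and Hfs: "H1_on s b f"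
    using b by (auto intro: H1_on_subinterval[OF Hg] H1_on_subinterval[OF Hf])
  show "H1_on s t (join b g f)" by (rule H1_on_join[OF b Hgs Hft meet])
  show "circle_proj (join b g f s) = circle_proj (f s)" "circle_proj (join b g f t) = circle_proj (f t)"
    using b s by (auto simp: join_right[where f = g and g = f] meet)
  have "lift_action \<theta> s b g \<le> lift_action \<theta> s b f"
    using s meet by (intro lift_minimizerD[OF lift_minimizer_prefix[OF g b]] Hfs) auto
  then show "lift_action \<theta> s t (join b g f) \<le> lift_action \<theta> s t f"
    by (simp add: lift_action_join[OF b Hgs Hft meet] lift_action_split[OF Hf b])
qed

section \<open>Straightness between atoms\<close>

definition straight :: "real \<Rightarrow> real \<Rightarrow> (real \<Rightarrow> real) \<Rightarrow> bool"
  where "straight s t f \<longleftrightarrow> (\<forall>a b. s \<le> a \<longrightarrow> a < b \<longrightarrow> b \<le> t \<longrightarrow>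
    (\<forall>r\<in>{a<..<b}. (r, circle_proj (f r)) \<notin> supp \<mu>) \<longrightarrow> (\<forall>r\<in>{a..b}. f r = chord a b f r))"

lemma straightD:
  assumes "straight s t f" "s \<le> a" "a < b" "b \<le> t" "\<And>r. a < r \<Longrightarrow> r < b \<Longrightarrow> (r, circle_proj (f r)) \<notin> supp \<mu>"
    "a \<le> r" "r \<le> b"
  shows "f r = chord a b f r"
  using assms unfolding straight_def by (metis atLeastAtMost_iff greaterThanLessThan_iff)

lemma straight_cong:
  assumes f: "straight s t f" and eq: "\<And>r. r \<in> {s..t} \<Longrightarrow> f r = g r"
  shows "straight s t g"
  unfolding straight_def
proof (intro allI impI ballI)
  fix a b r assume "s \<le> a" "a < b" "b \<le> t" "\<forall>r\<in>{a<..<b}. (r, circle_proj (g r)) \<notin> supp \<mu>" "r \<in> {a..b}"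
  then show "g r = chord a b g r"
    using straightD[OF f, of a b r] eq[of r] eq[of a] eq[of b] eq by (auto simp: chord_def)
qed

lemma straight_chord: "straight s t (chord s' t' f)"
proof -
  have "c + v * r = chord a b (\<lambda>r. c + v * r) r" if "a < b" for a b c v r :: real
  proof -
    have "(c + v * b - (c + v * a)) / (b - a) = v"
      using that by (simp add: field_simps)
    then show ?thesis unfolding chord_def by (simp add: algebra_simps)
  qed
  then show ?thesis unfolding straight_def chord_affine by blast
qed

lemma straight_join:
  assumes "straight s b f" "straight b t g" "f b = g b" "(b, circle_proj (f b)) \<in> supp \<mu>"
  shows "straight s t (join b f g)"
  unfolding straight_def
proof (intro allI impI ballI)
  fix a c r
  assume *: "s \<le> a" "a < c" "c \<le> t"
    "\<forall>r\<in>{a<..<c}. (r, circle_proj (join b f g r)) \<notin> supp \<mu>" "r \<in> {a..c}"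
  then have "\<not> (a < b \<and> b < c)" using assms(4) by force
  then consider "c \<le> b" | "b \<le> a" by linarith
  then show "join b f g r = chord a c (join b f g) r"
  proof cases
    case 1
    then have "f r = chord a c f r" using * by (intro straightD[OF assms(1)]) auto
    then show ?thesis using * 1 by (simp add: chord_def)
  next
    case 2
    note j = join_right[where f = f and g = g, OF assms(3)]
    have "g r = chord a c g r" using * 2 by (intro straightD[OF assms(2)]) (auto simp: j)
    then show ?thesis using * 2 by (simp add: chord_def j)
  qed
qed

text \<open>Replacing \<open>f\<close> by its chord on \<open>[a, b]\<close> loses no reward, since \<open>f\<close> can hit an atom on
  \<open>[a, b)\<close> only at the initial point, which the chord shares. Minimality then forces equality of energies.\<close>

lemma lift_minimizer_straight:
  assumes f: "lift_minimizer \<theta> s t f"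
  shows "straight s t f"
  unfolding straight_def
proof (intro allI impI ballI)
  fix a b r
  assume ab: "s \<le> a" "a < b" "b \<le> t"
    and free: "\<forall>r\<in>{a<..<b}. (r, circle_proj (f r)) \<notin> supp \<mu>" and r: "r \<in> {a..b}"
  have fab: "lift_minimizer \<theta> a b f"
    using ab lift_minimizer_prefix[OF lift_minimizer_suffix[OF f, of a], of b] by simp
  have "lift_action \<theta> a b f \<le> lift_action \<theta> a b (chord a b f)"
    using ab by (intro lift_minimizerD[OF fab] H1_on_chord) auto
  moreover have "reward a b f \<le> reward a b (chord a b f)"
  proof (rule reward_mono)
    fix r assume "r \<in> hits a b f"
    then have "r = a" using free by (auto simp: hits_def less_le)
    then show "circle_proj (chord a b f r) = circle_proj (f r)" by simp
  qed
  ultimately have "energy \<theta> a b f \<le> chord_cost \<theta> a b f"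
    using energy_chord[of a b \<theta> f] ab by (simp add: lift_action_def)
  then show "f r = chord a b f r"
    using ab r by (intro energy_eq_chord_cost_imp[OF lift_minimizer_H1[OF fab]])
qed

text \<open>By induction on the number of atom times inside the interval: a path that hits no atom in the open
  interval is replaced by its chord, and otherwise it is cut at an atom that it hits. The cut remains a
  hit of the new path, so straightness is preserved when the two pieces are joined.\<close>

lemma exists_straight_competitor:
  assumes "H1_on s t f" "s < t"
  shows "\<exists>g. H1_on s t g \<and> straight s t g \<and> g s = f s \<and> g t = f t \<and>
    lift_action \<theta> s t g \<le> lift_action \<theta> s t f"
  using assms
proof (induction "card (fst ` (supp \<mu> \<inter> ({s<..<t} \<times> UNIV)))" arbitrary: s t f rule: less_induct)
  case less
  let ?T = "\<lambda>s t. fst ` (supp \<mu> \<inter> ({s<..<t} \<times> (UNIV :: circle set)))"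
  have finT: "finite (?T s t)" for s t
    by (rule finite_imageI, rule finite_subset[OF _ finite_supp_strip[of s t]]) auto
  show ?case
  proof (cases "\<exists>r\<in>{s<..<t}. (r, circle_proj (f r)) \<in> supp \<mu>")
    case False
    have "reward s t f \<le> reward s t (chord s t f)"
    proof (rule reward_mono)
      fix r assume "r \<in> hits s t f"
      then have "r = s" using False by (auto simp: hits_def less_le)
      then show "circle_proj (chord s t f r) = circle_proj (f r)" by simp
    qed
    then have "lift_action \<theta> s t (chord s t f) \<le> lift_action \<theta> s t f"
      using energy_ge_chord_cost[OF less.prems] less.prems(2)
      by (simp add: lift_action_def energy_chord diff_mono)
    then show ?thesis
      using less.prems by (intro exI[of _ "chord s t f"]) (auto simp: H1_on_chord straight_chord)
  next
    case True
    then obtain r where r: "s < r" "r < t" and hit: "(r, circle_proj (f r)) \<in> supp \<mu>" by auto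
    then have rT: "r \<in> ?T s t" by (auto intro!: rev_image_eqI)
    have "?T s r \<subset> ?T s t" "?T r t \<subset> ?T s t" using r rT by auto
    note c = this[THEN psubset_card_mono[OF finT]]
    have H: "H1_on s r f" "H1_on r t f"
      using r by (auto intro: H1_on_subinterval[OF less.prems(1)])
    obtain g where g: "H1_on s r g" "straight s r g" "g s = f s" "g r = f r"
        "lift_action \<theta> s r g \<le> lift_action \<theta> s r f"
      using less.hyps[OF c(1) H(1) r(1)] by blast
    obtain h where h: "H1_on r t h" "straight r t h" "h r = f r" "h t = f t"
        "lift_action \<theta> r t h \<le> lift_action \<theta> r t f"
      using less.hyps[OF c(2) H(2) r(2)] by blast
    have r': "s \<le> r" "r \<le> t" and gh: "g r = h r" using r g h by auto
    have "lift_action \<theta> s t (join r g h) \<le> lift_action \<theta> s t f"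
      using g h by (simp add: lift_action_join[OF r' g(1) h(1) gh] lift_action_split[OF less.prems(1) r'])
    then show ?thesis
      using r g h hit gh
      by (intro exI[of _ "join r g h"])
         (auto intro!: H1_on_join straight_join simp: join_right[where f = g and g = h])
  qed
qed

text \<open>A straight path is recovered from the times at which it hits an atom, the two end times included, and
  its values there, by interpolating between neighbouring times. Only finitely many such data exist if
  the values are bounded.\<close>

lemma finite_straight:
  assumes "s < t"
  shows "finite {f \<in> extensional {s..t}. straight s t f \<and> f t = x \<and> circle_proj (f s) = y \<and>
    (\<forall>r\<in>{s..t}. \<bar>f r\<bar> \<le> B)}" (is "finite ?F")
proof -
  define N where "N = supp \<mu> \<inter> ({s..t} \<times> UNIV)"
  define H where "H = (\<lambda>f. insert s (insert t (hits s t f)))"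
  define T where "T = insert s (insert t (fst ` N))"
  define V where "V = {z. \<bar>z\<bar> \<le> B \<and> circle_proj z \<in> insert y (insert (circle_proj x) (snd ` N))}"
  have N: "finite N" unfolding N_def by (rule finite_supp_strip)
  have H_sub: "H f \<subseteq> {s..t}" and H_fin: "finite (H f)" for f
    using assms by (auto simp: H_def finite_hits) (auto simp: hits_def)
  have T_fin: "finite T" and V_fin: "finite V"
    unfolding T_def V_def using N by (auto intro: finite_bounded_lifts simp del: insert_iff)
  have "finite (SIGMA A : Pow T. PiE A (\<lambda>_. V))"
  proof (rule finite_SigmaI)
    fix A assume "A \<in> Pow T"
    then have "finite A" using T_fin finite_subset by blast
    then show "finite (PiE A (\<lambda>_. V))" using V_fin by (intro finite_PiE)
  qed (simp add: T_fin)
  moreover have "(\<lambda>f. (H f, restrict f (H f))) ` ?F \<subseteq> (SIGMA A : Pow T. PiE A (\<lambda>_. V))"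
  proof (rule image_subsetI, rule SigmaI)
    fix f assume f: "f \<in> ?F"
    show "H f \<in> Pow T"
      by (auto simp: H_def T_def N_def hits_def intro!: rev_image_eqI)
    show "restrict f (H f) \<in> PiE (H f) (\<lambda>_. V)"
    proof (rule restrict_PiE_iff[THEN iffD2], rule ballI)
      fix r assume r: "r \<in> H f"
      then have "circle_proj (f r) \<in> insert y (insert (circle_proj x) (snd ` N))"
        using f assms by (auto simp: H_def hits_def N_def intro!: rev_image_eqI)
      moreover have "\<bar>f r\<bar> \<le> B" using f r H_sub by blast
      ultimately show "f r \<in> V" by (simp add: V_def)
    qed
  qed
  moreover have "inj_on (\<lambda>f. (H f, restrict f (H f))) ?F"
  proof (rule inj_onI)
    fix f g assume f: "f \<in> ?F" and g: "g \<in> ?F" and eq: "(H f, restrict f (H f)) = (H g, restrict g (H g))"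
    have Heq: "H f = H g" using eq by simp
    have fg: "f r = g r" if "r \<in> H f" for r
      using eq that by (metis Pair_inject restrict_apply')
    show "f = g"
    proof (rule extensionalityI[of _ "{s..t}"])
      fix r assume r: "r \<in> {s..t}"
      show "f r = g r"
      proof (cases "r \<in> H f")
        case False
        then have st: "s < r" "r < t" using r by (auto simp: H_def less_le)
        \<comment> \<open>The neighbours of \<open>r\<close> among the encoded times; no atom is hit strictly between them.\<close>
        define a where "a = Max {h \<in> H f. h < r}"
        define b where "b = Min {h \<in> H f. r < h}"
        have fin: "finite {h \<in> H f. h < r}" "finite {h \<in> H f. r < h}" using H_fin by auto
        have ne: "{h \<in> H f. h < r} \<noteq> {}" "{h \<in> H f. r < h} \<noteq> {}"
          using st by (auto simp: H_def)
        have a: "a \<in> H f" "a < r" using Max_in[OF fin(1) ne(1)] by (auto simp: a_def)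
        have b: "b \<in> H f" "r < b" using Min_in[OF fin(2) ne(2)] by (auto simp: b_def)
        have ab: "s \<le> a" "b \<le> t" using a(1) b(1) H_sub by fastforce+
        have gap: "u \<notin> H f" if \<open>a < u\<close> \<open>u < b\<close> for u
        proof
          assume u: "u \<in> H f"
          then consider "u < r" | "r < u" using False by (metis linorder_neqE)
          then show False
          proof cases
            case 1
            then have "u \<le> a" using fin(1) u by (simp add: a_def)
            then show False using \<open>a < u\<close> by simp
          next
            case 2
            then have "b \<le> u" using fin(2) u by (simp add: b_def)
            then show False using \<open>u < b\<close> by simp
          qed
        qed
        have "f r = chord a b f r"
        proof (rule straightD[of s t f a b r])
          fix u assume "a < u" "u < b"
          then show "(u, circle_proj (f u)) \<notin> supp \<mu>"
            using gap[of u] ab by (auto simp: H_def hits_def)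
        qed (use f a b ab in auto)
        moreover have "g r = chord a b g r"
        proof (rule straightD[of s t g a b r])
          fix u assume "a < u" "u < b"
          then show "(u, circle_proj (g u)) \<notin> supp \<mu>"
            using gap[of u] ab unfolding Heq by (auto simp: H_def hits_def)
        qed (use g a b ab in auto)
        ultimately show ?thesis using fg[OF a(1)] fg[OF b(1)] by (simp add: chord_def)
      qed (simp add: fg)
    qed (use f g in auto)
  qed
  ultimately show ?thesis by (metis (no_types, lifting) finite_imageD finite_subset)
qed

end

section \<open>Existence of minimizers and extremal minimizers\<close>

lemma positive_if_no_zero:
  fixes u :: "real \<Rightarrow> real"
  assumes u: "continuous_on {p..q} u" and nz: "\<And>z. z \<in> {p..q} \<Longrightarrow> u z \<noteq> 0"
    and r: "r \<in> {p..q}" "0 < u r" and z: "z \<in> {p..q}"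
  shows "0 < u z"
proof (rule ccontr)
  assume "\<not> 0 < u z"
  then have uz: "u z \<le> 0" by simp
  have "\<exists>c\<in>{p..q}. u c = 0"
  proof (cases "z \<le> r")
    case True
    then show ?thesis
      using IVT'[of u z 0 r] uz r z continuous_on_subset[OF u, of "{z..r}"] by force
  next
    case False
    then show ?thesis
      using IVT2'[of u z 0 r] uz r z continuous_on_subset[OF u, of "{r..z}"] by force
  qed
  then show False using nz by blast
qed

context point_potential
begin

text \<open>The bound on \<open>\<bar>f r\<bar>\<close> that \<open>displacement_le_energy\<close> gives for a lift with terminal value \<open>x\<close> and
  action at most \<open>C\<close>: the energy is at most \<open>C\<close> plus all the mass available in the strip.\<close>

definition amplitude :: "real \<Rightarrow> real \<Rightarrow> real \<Rightarrow> real \<Rightarrow> real \<Rightarrow> real"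
  where "amplitude \<theta> s t C x = \<bar>x\<bar> + \<bar>\<theta>\<bar> * (t - s) + sqrt (2 * (t - s) * \<bar>C + total_mass s t\<bar>)"

lemma abs_le_amplitude:
  assumes f: "H1_on s t f" and C: "lift_action \<theta> s t f \<le> C" and r: "r \<in> {s..t}"
  shows "\<bar>f r\<bar> \<le> amplitude \<theta> s t C (f t)"
proof (cases "r = t")
  case True
  have "0 \<le> \<bar>\<theta>\<bar> * (t - s) + sqrt (2 * (t - s) * \<bar>C + total_mass s t\<bar>)"
    using r by (intro add_nonneg_nonneg) auto
  then show ?thesis using True by (simp add: amplitude_def)
next
  case False
  then have r: "s \<le> r" "r < t" using r by auto
  let ?K = "\<bar>C + total_mass s t\<bar>"
  have "energy \<theta> r t f \<le> energy \<theta> s t f"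
    using energy_split[OF f r(1), of \<theta>] energy_nonneg[of \<theta> s r f] r by simp
  also have "\<dots> \<le> C + total_mass s t"
    using C reward_le_total_mass[of s t f] by (simp add: lift_action_def)
  finally have K: "energy \<theta> r t f \<le> ?K" by linarith
  have "(f t - f r - \<theta> * (t - r))\<^sup>2 \<le> 2 * (t - r) * energy \<theta> r t f"
    using r by (intro displacement_le_energy H1_on_subinterval[OF f]) auto
  also have "\<dots> \<le> 2 * (t - s) * ?K"
    using r K by (intro mult_mono energy_nonneg) auto
  finally have "\<bar>f t - f r - \<theta> * (t - r)\<bar> \<le> sqrt (2 * (t - s) * ?K)"
    by (metis real_le_rsqrt real_sqrt_abs real_sqrt_le_mono)
  moreover have "\<bar>\<theta> * (t - r)\<bar> \<le> \<bar>\<theta>\<bar> * (t - s)"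
    using r by (auto simp: abs_mult intro!: mult_left_mono)
  ultimately show ?thesis by (simp add: amplitude_def)
qed

text \<open>Restricting to extensional functions makes the set finite: values off the interval are irrelevant.\<close>

definition competitors :: "real \<Rightarrow> real \<Rightarrow> real \<Rightarrow> circle \<Rightarrow> real \<Rightarrow> real \<Rightarrow> (real \<Rightarrow> real) set"
  where "competitors \<theta> s t y x C = {f \<in> extensional {s..t}. H1_on s t f \<and> straight s t f \<and>
    f t = x \<and> circle_proj (f s) = y \<and> lift_action \<theta> s t f \<le> C}"

lemma finite_competitors:
  assumes "s < t" shows "finite (competitors \<theta> s t y x C)"
  by (rule finite_subset[OF _ finite_straight[OF assms, of x y "amplitude \<theta> s t C x"]])
     (auto simp: competitors_def intro: abs_le_amplitude)

lemma straighten_into_competitors: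
  assumes f: "H1_on s t f" and "s < t" and C: "lift_action \<theta> s t f \<le> C"
    and ends: "f t = x" "circle_proj (f s) = y"
  obtains g where "g \<in> competitors \<theta> s t y x C" "lift_action \<theta> s t g \<le> lift_action \<theta> s t f"
proof -
  obtain g where g: "H1_on s t g" "straight s t g" "g s = f s" "g t = f t"
      "lift_action \<theta> s t g \<le> lift_action \<theta> s t f"
    using exists_straight_competitor[OF f \<open>s < t\<close>] by blast
  have A: "lift_action \<theta> s t g = lift_action \<theta> s t (restrict g {s..t})"
    by (rule lift_action_cong[OF g(1)]) simp
  have "H1_on s t (restrict g {s..t})" by (rule H1_on_cong[OF g(1)]) simp
  moreover have "straight s t (restrict g {s..t})" by (rule straight_cong[OF g(2)]) simp
  ultimately have "restrict g {s..t} \<in> competitors \<theta> s t y x C"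
    using g(3-5) ends C \<open>s < t\<close> by (auto simp: competitors_def simp flip: A)
  then show thesis using that A g(5) by simp
qed

text \<open>With \<open>C\<close> the action of one admissible path, a path that does better than \<open>C\<close> can be translated to the
  right terminal value and then straightened into the finite set of competitors; so the best competitor
  is a minimizer.\<close>

lemma exists_lift_minimizer:
  assumes "s < t"
  shows "\<exists>f. lift_minimizer \<theta> s t f \<and> f t = x \<and> circle_proj (f s) = y"
proof -
  obtain y\<^sub>0 where y0: "y = circle_proj y\<^sub>0" by (rule circle_proj_surj)
  define f\<^sub>0 where "f\<^sub>0 = chord s t (\<lambda>r. if r = t then x else y\<^sub>0)"
  define C where "C = lift_action \<theta> s t f\<^sub>0"
  have f0: "H1_on s t f\<^sub>0" "f\<^sub>0 t = x" "circle_proj (f\<^sub>0 s) = y"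
    using assms by (auto simp: f\<^sub>0_def y0 H1_on_chord)
  have "competitors \<theta> s t y x C \<noteq> {}"
    using straighten_into_competitors[OF f0(1) assms order_refl f0(2,3)] unfolding C_def by blast
  then obtain f where f: "f \<in> competitors \<theta> s t y x C"
    and min: "\<And>g. g \<in> competitors \<theta> s t y x C \<Longrightarrow> lift_action \<theta> s t f \<le> lift_action \<theta> s t g"
    using arg_min_if_finite[of "competitors \<theta> s t y x C" "lift_action \<theta> s t"] finite_competitors[OF assms]
    by (metis not_le)
  have fx: "f t = x" and fy: "circle_proj (f s) = y" and fC: "lift_action \<theta> s t f \<le> C"
    using f by (auto simp: competitors_def)
  have "lift_action \<theta> s t f \<le> lift_action \<theta> s t g"
    if g: "H1_on s t g" "circle_proj (g s) = circle_proj (f s)" "circle_proj (g t) = circle_proj (f t)" for g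
  proof (cases "lift_action \<theta> s t g \<le> C")
    case True
    define k where "k = f t - g t"
    have k: "k \<in> \<int>" using g(3) by (metis circle_proj_eq_iff k_def)
    have "H1_on s t (\<lambda>r. g r + k)" "lift_action \<theta> s t (\<lambda>r. g r + k) \<le> C" "g t + k = x" "circle_proj (g s + k) = y"
      using g True fx fy k by (auto simp: H1_on_add_const lift_action_add_Int circle_proj_add_Int k_def)
    from straighten_into_competitors[OF this(1) assms this(2) this(3,4)]
    show ?thesis using min k by (metis lift_action_add_Int order_trans)
  qed (use fC in simp)
  then show ?thesis
    using f fx fy by (intro exI[of _ f]) (auto simp: lift_minimizer_def competitors_def)
qed

text \<open>If \<open>g\<close> lies strictly below \<open>f\<close> at time \<open>r\<close> (in the order given by the sign of \<open>\<epsilon>\<close>), then following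
  \<open>g\<close> between the last meeting before \<open>r\<close> and the first meeting after \<open>r\<close> gives a minimizer that
  nowhere exceeds \<open>f\<close>. There is always a meeting at the end \<open>t\<close>. If there is none before \<open>r\<close>, then
  \<open>g\<close> is followed from the start, which is legitimate because the initial values agree modulo
  integers.\<close>

lemma lift_minimizer_switch:
  assumes f: "lift_minimizer \<theta> s t f" and g: "lift_minimizer \<theta> s t g"
    and ends: "f t = g t" "circle_proj (g s) = circle_proj (f s)"
    and r: "r \<in> {s..t}" "\<epsilon> * g r < \<epsilon> * f r"
  obtains h where "lift_minimizer \<theta> s t h" "h t = f t" "circle_proj (h s) = circle_proj (f s)"
    "\<And>z. z \<in> {s..t} \<Longrightarrow> \<epsilon> * h z \<le> \<epsilon> * f z" "h r = g r"
proof -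
  define u where "u = (\<lambda>z. \<epsilon> * f z - \<epsilon> * g z)"
  have cont: "continuous_on {s..t} u"
    unfolding u_def
    by (intro continuous_intros H1_on_continuous_on lift_minimizer_H1[OF f] lift_minimizer_H1[OF g])
  have ur: "0 < u r" using r by (simp add: u_def)
  have zeros: "compact {z \<in> {p..q}. u z = 0}" if "s \<le> p" "q \<le> t" for p q
  proof -
    have "continuous_on {p..q} u" using that by (intro continuous_on_subset[OF cont]) auto
    then have "closed {z \<in> {p..q}. u z = 0}"
      by (intro continuous_closed_preimage_constant) auto
    then show ?thesis
      by (rule compact_Int_closed[OF compact_Icc[of p q], THEN back_subst[of compact]]) auto
  qed
  have eq_if_zero: "g z = f z" if "u z = 0" for z
    using that r by (auto simp: u_def)
  have "{z \<in> {r..t}. u z = 0} \<noteq> {}" using r ends by (auto simp: u_def)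
  then obtain b where b: "r \<le> b" "b \<le> t" "u b = 0"
      and b_least: "\<And>z. z \<in> {r..t} \<Longrightarrow> u z = 0 \<Longrightarrow> b \<le> z"
    using compact_attains_inf[OF zeros[of r t]] r by auto
  have rb: "r < b" using b ur by (auto simp: less_le)
  have sb: "s \<le> b" using rb r by simp
  \<comment> \<open>This path may exceed \<open>f\<close> before \<open>r\<close>, if the two meet there; that part is replaced by \<open>f\<close> in the second case below.\<close>
  define h\<^sub>1 where "h\<^sub>1 = join b g f"
  note fb = eq_if_zero[OF b(3)]
  have h1: "lift_minimizer \<theta> s t h\<^sub>1"
    unfolding h\<^sub>1_def by (rule lift_minimizer_join[OF f g sb b(2) fb ends(2)])
  have right: "h\<^sub>1 z = f z" if "b \<le> z" for z
    using that by (simp add: h\<^sub>1_def join_right[where f = g and g = f] fb)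
  have left: "h\<^sub>1 z = g z" if "z \<le> b" for z using that by (simp add: h\<^sub>1_def)
  \<comment> \<open>A point \<open>p\<close> after which no meeting occurs up to \<open>r\<close> starts an interval, ending at \<open>b\<close>, on which the order is constant.\<close>
  have u_pos: "0 \<le> u z" if p: "s \<le> p" "p \<le> r" "\<And>c. p < c \<Longrightarrow> c \<le> r \<Longrightarrow> u c \<noteq> 0" and z: "p < z" "z \<le> b" for p z
  proof (cases "z = b")
    case False
    define q where "q = max z r"
    define p' where "p' = min z r"
    have "q < b" using False z rb by (auto simp: q_def)
    have "0 < u z"
    proof (rule positive_if_no_zero[of p' q u r z])
      show "continuous_on {p'..q} u"
        using p z r b \<open>q < b\<close> by (intro continuous_on_subset[OF cont]) (auto simp: p'_def)
      fix c assume c: "c \<in> {p'..q}"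
      show "u c \<noteq> 0"
      proof (cases "c \<le> r")
        case True
        then show ?thesis
          using c p(3)[of c] z ur by (cases "c = r") (auto simp: p'_def min_def split: if_splits)
      next
        case False
        then show ?thesis using b_least[of c] c \<open>q < b\<close> b(2) by auto
      qed
    qed (auto simp: p'_def q_def ur)
    then show ?thesis by simp
  qed (simp add: b)
  show thesis
  proof (cases "{z \<in> {s..r}. u z = 0} = {}")
    case True
    have us: "0 \<le> u z" if "z \<in> {s..b}" for z
    proof (cases "z = s")
      case True
      have "0 < u s"
      proof (rule positive_if_no_zero[of s r u r s])
        show "continuous_on {s..r} u" using r by (intro continuous_on_subset[OF cont]) auto
      qed (use \<open>{z \<in> {s..r}. u z = 0} = {}\<close> r ur in auto)
      then show ?thesis using True by simp
    next
      case False
      then show ?thesis using u_pos[of s z] that r \<open>{z \<in> {s..r}. u z = 0} = {}\<close> by auto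
    qed
    show thesis
    proof (rule that[OF h1])
      fix z assume "z \<in> {s..t}"
      then show "\<epsilon> * h\<^sub>1 z \<le> \<epsilon> * f z"
        using us[of z] by (cases "z \<le> b") (auto simp: left right u_def)
    qed (use left[of r] left[of s] right[of t] rb sb b ends in auto)
  next
    case False
    then obtain a where a: "s \<le> a" "a \<le> r" "u a = 0"
        and a_greatest: "\<And>z. z \<in> {s..r} \<Longrightarrow> u z = 0 \<Longrightarrow> z \<le> a"
      using compact_attains_sup[OF zeros[of s r]] r by auto
    have at: "a \<le> t" and ar: "a < r" using a r ur by (auto simp: less_le)
    have fa: "f a = h\<^sub>1 a" using eq_if_zero[OF a(3)] left[of a] ar rb by simp
    have h: "lift_minimizer \<theta> s t (join a f h\<^sub>1)"
      using left[of s] sb ends by (intro lift_minimizer_join[OF h1 f a(1) at fa]) simp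
    note jr = join_right[where f = f and g = h\<^sub>1, OF fa]
    have nz: "u c \<noteq> 0" if "a < c" "c \<le> r" for c
      using a_greatest[of c] a(1) that by auto
    show thesis
    proof (rule that[OF h])
      show "join a f h\<^sub>1 t = f t" using at right[of t] b by (simp add: jr)
      show "circle_proj (join a f h\<^sub>1 s) = circle_proj (f s)" using a by simp
      show "join a f h\<^sub>1 r = g r" using left[of r] ar rb by (simp add: jr)
      fix z assume z: "z \<in> {s..t}"
      show "\<epsilon> * join a f h\<^sub>1 z \<le> \<epsilon> * f z"
      proof (cases "z \<le> a")
        case False
        have "0 \<le> u z" if "z \<le> b"
          using u_pos[OF a(1,2) nz _ that] False by simp
        then show ?thesis
          using False by (cases "z \<le> b") (auto simp: left right u_def join_def)
      qed simp
    qed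
  qed
qed

text \<open>The minimizers form a finite set, so one of them is minimal in the pointwise order; by
  \<open>lift_minimizer_switch\<close> a minimizer that is not above it somewhere would produce a smaller one. The
  lowest minimizer is obtained for \<open>\<epsilon> > 0\<close> and the highest one for \<open>\<epsilon> < 0\<close>.\<close>

lemma exists_extremal_lift_minimizer:
  assumes "s < t" "\<epsilon> \<noteq> 0"
  shows "\<exists>f. lift_minimizer \<theta> s t f \<and> f t = x \<and> circle_proj (f s) = y \<and>
    (\<forall>g. lift_minimizer \<theta> s t g \<longrightarrow> g t = x \<longrightarrow> circle_proj (g s) = y \<longrightarrow>
      (\<forall>r\<in>{s..t}. \<epsilon> * f r \<le> \<epsilon> * g r))"
proof -
  define S where "S = {f \<in> extensional {s..t}. lift_minimizer \<theta> s t f \<and> f t = x \<and> circle_proj (f s) = y}"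
  have restr: "restrict f {s..t} \<in> S"
    if "lift_minimizer \<theta> s t f" "f t = x" "circle_proj (f s) = y" for f
    using that assms lift_minimizer_cong[OF that(1), of "restrict f {s..t}"] by (auto simp: S_def)
  obtain m where m: "lift_minimizer \<theta> s t m" "m t = x" "circle_proj (m s) = y"
    using exists_lift_minimizer[OF assms(1)] by blast
  have "S \<subseteq> competitors \<theta> s t y x (lift_action \<theta> s t m)"
    using m lift_minimizerD[OF _ lift_minimizer_H1[OF m(1)]]
    by (auto simp: S_def competitors_def lift_minimizer_H1 lift_minimizer_straight)
  then have "finite ((\<lambda>f r. \<epsilon> * f r) ` S)"
    using finite_competitors[OF assms(1)] finite_subset by blast
  moreover have "(\<lambda>f r. \<epsilon> * f r) ` S \<noteq> {}" using restr[OF m] by blast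
  ultimately obtain f where f: "f \<in> S"
    and minimal: "\<And>h. h \<in> S \<Longrightarrow> (\<lambda>r. \<epsilon> * h r) \<le> (\<lambda>r. \<epsilon> * f r) \<Longrightarrow> (\<lambda>r. \<epsilon> * f r) = (\<lambda>r. \<epsilon> * h r)"
    using finite_has_minimal[of "(\<lambda>f r. \<epsilon> * f r) ` S"] by (auto simp: image_iff)
  have fm: "lift_minimizer \<theta> s t f" "f t = x" "circle_proj (f s) = y" "f \<in> extensional {s..t}"
    using f by (auto simp: S_def)
  have "\<epsilon> * f r \<le> \<epsilon> * g r"
    if g: "lift_minimizer \<theta> s t g" "g t = x" "circle_proj (g s) = y" and r: "r \<in> {s..t}" for g r
  proof (rule ccontr)
    assume "\<not> \<epsilon> * f r \<le> \<epsilon> * g r"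
    then have lt: "\<epsilon> * g r < \<epsilon> * f r" by simp
    obtain h where h: "lift_minimizer \<theta> s t h" "h t = f t" "circle_proj (h s) = circle_proj (f s)"
        "\<And>z. z \<in> {s..t} \<Longrightarrow> \<epsilon> * h z \<le> \<epsilon> * f z" "h r = g r"
      using lift_minimizer_switch[OF fm(1) g(1) _ _ r lt] fm g by metis
    have "restrict h {s..t} \<in> S" using h fm by (intro restr) auto
    moreover have "(\<lambda>z. \<epsilon> * restrict h {s..t} z) \<le> (\<lambda>z. \<epsilon> * f z)"
      using h(4) fm(4) by (auto simp: le_fun_def extensional_def)
    ultimately have "(\<lambda>z. \<epsilon> * f z) = (\<lambda>z. \<epsilon> * restrict h {s..t} z)" by (rule minimal)
    then have "\<epsilon> * f r = \<epsilon> * h r" using r by (metis restrict_apply')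
    then show False using lt h(5) by auto
  qed
  then show ?thesis using fm by blast
qed

section \<open>Atoms that every minimizer visits\<close>

text \<open>A minimizer that misses the atom is a chord with some velocity \<open>v\<close> through the window, with action at
  least \<open>(v - \<theta>)\<^sup>2 M\<close>. The competitor \<open>g\<close> moves the middle point by \<open>h\<close> to the nearest lift of \<open>y\<close>, so
  its two velocities are \<open>v + h / M\<close> and \<open>v - h / M\<close>; the mixed terms cancel and the energy grows by
  \<open>h\<^sup>2 / M \<le> 1 / (4 M)\<close>, which is less than the mass of the atom.\<close>

lemma lift_minimizer_meets_atom:
  assumes f: "lift_minimizer \<theta> s t f" and "s \<le> \<sigma> - M" "\<sigma> + M \<le> t" "0 < M"
    and only: "supp \<mu> \<inter> ({\<sigma> - M..\<sigma> + M} \<times> UNIV) = {(\<sigma>, y)}"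
    and heavy: "measure \<mu> {(\<sigma>, y)} > 1 / (4 * M)"
  shows "circle_proj (f \<sigma>) = y"
proof (rule ccontr)
  assume miss: "circle_proj (f \<sigma>) \<noteq> y"
  define a where "a = \<sigma> - M"
  define b where "b = \<sigma> + M"
  have ab: "s \<le> a" "a < \<sigma>" "\<sigma> < b" "b \<le> t" "\<sigma> - a = M" "b - \<sigma> = M" "b - a = 2 * M"
    using assms by (auto simp: a_def b_def)
  have fab: "lift_minimizer \<theta> a b f"
    using ab lift_minimizer_prefix[OF lift_minimizer_suffix[OF f, of a], of b] by simp
  have free: "(r, circle_proj (f r)) \<notin> supp \<mu>" if "a \<le> r" "r \<le> b" for r
  proof
    assume "(r, circle_proj (f r)) \<in> supp \<mu>"
    then have "(r, circle_proj (f r)) \<in> {(\<sigma>, y)}"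
      using that unfolding only[symmetric] by (simp add: a_def b_def)
    then show False using miss by auto
  qed
  define v where "v = (f b - f a) / (b - a)"
  have mid: "f \<sigma> = f a + v * M"
    using straightD[OF lift_minimizer_straight[OF fab], of a b \<sigma>] free ab
    by (simp add: chord_def v_def)
  have "v * (b - a) = f b - f a" using ab by (simp add: v_def)
  then have fb: "f b = f a + 2 * v * M" by (simp add: ab)
  have "hits a b f = {}" using free by (auto simp: hits_def)
  then have A: "(v - \<theta>)\<^sup>2 * M \<le> lift_action \<theta> a b f"
    using energy_ge_chord_cost[OF lift_minimizer_H1[OF fab], of \<theta>] ab
    by (simp add: lift_action_def reward_def chord_cost_def v_def)
  obtain z where z: "circle_proj z = y" "\<bar>z - f \<sigma>\<bar> \<le> 1/2" by (rule circle_proj_nearest_lift)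
  define h where "h = z - f \<sigma>"
  define w where "w = f(\<sigma> := z)"
  define g where "g = join \<sigma> (chord a \<sigma> w) (chord \<sigma> b w)"
  have w: "w a = f a" "w \<sigma> = z" "w b = f b" using ab by (auto simp: w_def)
  have ab': "a \<le> \<sigma>" "\<sigma> \<le> b" using ab by auto
  have meet: "chord a \<sigma> w \<sigma> = chord \<sigma> b w \<sigma>" using ab by simp
  have Hg: "H1_on a b g"
    unfolding g_def using ab' meet by (intro H1_on_join H1_on_chord)
  have ends: "g a = f a" "g b = f b" "g \<sigma> = z"
    using ab by (auto simp: g_def w join_right[where f = "chord a \<sigma> w" and g = "chord \<sigma> b w", OF meet])
  have "energy \<theta> a b g = energy \<theta> a \<sigma> (chord a \<sigma> w) + energy \<theta> \<sigma> b (chord \<sigma> b w)"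
  proof -
    have "energy \<theta> a \<sigma> (chord a \<sigma> w) = energy \<theta> a \<sigma> g"
      using ab by (intro energy_cong H1_on_chord) (auto simp: g_def)
    moreover have "energy \<theta> \<sigma> b (chord \<sigma> b w) = energy \<theta> \<sigma> b g"
      using ab by (intro energy_cong H1_on_chord)
        (auto simp: g_def join_right[where f = "chord a \<sigma> w" and g = "chord \<sigma> b w", OF meet])
    ultimately show ?thesis using energy_split[OF Hg ab'] by simp
  qed
  also have "\<dots> = chord_cost \<theta> a \<sigma> w + chord_cost \<theta> \<sigma> b w"
    using ab by (simp add: energy_chord)
  also have "\<dots> = (v + h / M - \<theta>)\<^sup>2 * M / 2 + (v - h / M - \<theta>)\<^sup>2 * M / 2"
  proof -
    have "w \<sigma> - w a = v * M + h" "w b - w \<sigma> = v * M - h"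
      by (simp_all add: w h_def fb mid)
    then have "(w \<sigma> - w a) / (\<sigma> - a) = v + h / M" "(w b - w \<sigma>) / (b - \<sigma>) = v - h / M"
      using \<open>0 < M\<close> by (simp_all add: ab(5,6) add_divide_distrib diff_divide_distrib)
    then show ?thesis by (simp add: chord_cost_def ab)
  qed
  also have "\<dots> = (v - \<theta>)\<^sup>2 * M + h\<^sup>2 / M"
    using \<open>0 < M\<close> by (simp add: field_simps power2_eq_square)
  also have "\<dots> \<le> (v - \<theta>)\<^sup>2 * M + 1 / (4 * M)"
  proof -
    have "h\<^sup>2 \<le> (1/2)\<^sup>2" using z(2) by (intro abs_le_square_iff[THEN iffD1]) (simp add: h_def)
    then show ?thesis using \<open>0 < M\<close> by (simp add: field_simps power2_eq_square)
  qed
  finally have Eg: "energy \<theta> a b g \<le> (v - \<theta>)\<^sup>2 * M + 1 / (4 * M)" .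
  have "\<sigma> \<in> hits a b g"
    using only ab by (auto simp: hits_def ends z)
  then have "mass \<sigma> (g \<sigma>) \<le> reward a b g"
    unfolding reward_def by (intro member_le_sum finite_hits) auto
  then have "lift_action \<theta> a b g < lift_action \<theta> a b f"
    using A Eg heavy by (simp add: lift_action_def ends z)
  moreover have "lift_action \<theta> a b f \<le> lift_action \<theta> a b g"
    by (rule lift_minimizerD[OF fab Hg]) (simp_all add: ends)
  ultimately show False by simp
qed

end

section \<open>Circle-valued paths and their lifts\<close>

text \<open>The difference of two lifts that are differentiable at \<open>r\<close> is integer-valued near \<open>r\<close> and continuous
  at \<open>r\<close>, hence constant near \<open>r\<close>.\<close>

lemma circle_deriv_eq:
  assumes ev: "\<forall>\<^sub>F u in nhds r. X u = circle_proj (f u)"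
    and f: "(f has_real_derivative d) (at r)"
  shows "circle_deriv X r = d"
  unfolding circle_deriv_def
proof (rule the_equality)
  fix d' assume "\<exists>f. (\<forall>\<^sub>F u in nhds r. X u = circle_proj (f u)) \<and> (f has_real_derivative d') (at r)"
  then obtain g where evg: "\<forall>\<^sub>F u in nhds r. X u = circle_proj (g u)"
    and g: "(g has_real_derivative d') (at r)" by blast
  define h where "h = (\<lambda>u. f u - g u)"
  have h: "(h has_real_derivative d - d') (at r)"
    unfolding h_def by (intro DERIV_diff f g)
  have ints: "\<forall>\<^sub>F u in nhds r. h u \<in> \<int>"
    using ev evg by eventually_elim (metis h_def circle_proj_eq_iff)
  have "(h \<longlongrightarrow> h r) (nhds r)"
    using DERIV_isCont[OF h] by (simp add: isCont_def tendsto_at_iff_tendsto_nhds)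
  then have "\<forall>\<^sub>F u in nhds r. dist (h u) (h r) < 1"
    by (rule tendstoD) simp
  then have "\<forall>\<^sub>F u in nhds r. h u = h r"
    using ints
  proof eventually_elim
    case (elim u)
    have "h u - h r \<in> \<int>" using elim(2) eventually_nhds_x_imp_x[OF ints] by simp
    then show ?case
      using elim(1) Ints_nonzero_abs_less1[of "h u - h r"] by (simp add: dist_real_def)
  qed
  then have "(h has_real_derivative d - d') (at r) \<longleftrightarrow> ((\<lambda>_. h r) has_real_derivative d - d') (at r)"
    by (intro DERIV_cong_ev) simp_all
  then show "d' = d" using h DERIV_unique[OF _ DERIV_const] by fastforce
qed (use assms in blast)

lemma AE_circle_deriv:
  assumes f: "H1_on s t f" and X: "\<And>r. r \<in> {s..t} \<Longrightarrow> X r = circle_proj (f r)"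
  shows "AE r in lebesgue. r \<in> {s..t} \<longrightarrow> deriv f r = circle_deriv X r"
  using H1_on_differentiable[OF f] AE_lebesgue_neq[of s] AE_lebesgue_neq[of t]
proof eventually_elim
  case (elim r)
  show ?case
  proof
    assume "r \<in> {s..t}"
    then have r: "r \<in> {s<..<t}" using elim by auto
    have "\<forall>\<^sub>F u in nhds r. X u = circle_proj (f u)"
      using eventually_nhds_in_open[of "{s<..<t}" r] r by (auto elim!: eventually_mono intro: X)
    moreover have "(f has_real_derivative deriv f r) (at r)"
      using elim(1) r by (simp add: DERIV_deriv_iff_real_differentiable)
    ultimately show "deriv f r = circle_deriv X r"
      using circle_deriv_eq by metis
  qed
qed

lemma H1_path_lift:
  assumes X: "X \<in> H1_paths s t" and "s \<le> t" and x: "X t = circle_proj x"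
  obtains f where "H1_on s t f" "\<And>r. r \<in> {s..t} \<Longrightarrow> X r = circle_proj (f r)" "f t = x"
proof -
  obtain g where g: "H1_on s t g" "\<And>r. r \<in> {s..t} \<Longrightarrow> X r = circle_proj (g r)"
    using X by (auto simp: H1_paths_def)
  have k: "x - g t \<in> \<int>" using g(2)[of t] x \<open>s \<le> t\<close> by (simp flip: circle_proj_eq_iff)
  show thesis
    using g k by (intro that[of "\<lambda>r. g r + (x - g t)"] H1_on_add_const) (simp_all add: circle_proj_add_Int)
qed

text \<open>The lift with terminal value \<open>x\<close>, recovered from the path by integrating its derivative. It needs no
  choice, is the same on every interval ending at \<open>t\<close>, and turns \<open>path_le\<close> into the pointwise order.\<close>

definition lift_from_end :: "real \<Rightarrow> real \<Rightarrow> (real \<Rightarrow> circle) \<Rightarrow> real \<Rightarrow> real"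
  where "lift_from_end t x X r = x - (LINT u:{r..t}|lebesgue. circle_deriv X u)"

lemma lift_from_end_eq:
  assumes f: "H1_on s t f" and X: "\<And>r. r \<in> {s..t} \<Longrightarrow> X r = circle_proj (f r)" and r: "r \<in> {s..t}"
  shows "lift_from_end t (f t) X r = f r"
proof -
  have rt: "H1_on r t f" using r by (intro H1_on_subinterval[OF f]) auto
  have "AE u in lebesgue. u \<in> {r..t} \<longrightarrow> deriv f u = circle_deriv X u"
    using r by (intro AE_circle_deriv[OF rt] X) auto
  then have "(LINT u:{r..t}|lebesgue. deriv f u) = (LINT u:{r..t}|lebesgue. circle_deriv X u)"
    by (intro set_lebesgue_integral_lebesgue_cong_AE(2) H1_on_integrable[OF rt]) simp_all
  moreover have "f t - f r = (LINT u:{r..t}|lebesgue. deriv f u)"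
    using r by (intro H1_on_increment[OF f]) auto
  ultimately show ?thesis by (simp add: lift_from_end_def)
qed

text \<open>The inequality between integrals in \<open>path_le\<close> is reversed, because a larger displacement up to time
  \<open>t\<close> means a lower position at the earlier time.\<close>

lemma path_le_iff_lift_le:
  "path_le t X Y \<longleftrightarrow> (\<forall>r\<le>t. lift_from_end t x X r \<le> lift_from_end t x Y r)"
  by (simp add: path_le_def lift_from_end_def)

lemma lift_of_H1_loc_path:
  assumes X: "X \<in> H1_loc_paths t" and x: "X t = circle_proj x"
  shows "lift_from_end t x X t = x"
    and "\<And>s. s < t \<Longrightarrow> H1_on s t (lift_from_end t x X)"
    and "\<And>r. r \<le> t \<Longrightarrow> X r = circle_proj (lift_from_end t x X r)"
proof -
  have key: "H1_on s t (lift_from_end t x X) \<and> lift_from_end t x X t = x \<and>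
      (\<forall>r\<in>{s..t}. X r = circle_proj (lift_from_end t x X r))" if "s < t" for s
  proof -
    have "restrict X {s..t} \<in> H1_paths s t" using X that by (simp add: H1_loc_paths_def)
    moreover have "s \<le> t" "restrict X {s..t} t = circle_proj x" using x that by simp_all
    ultimately obtain f where f: "H1_on s t f"
        "\<And>r. r \<in> {s..t} \<Longrightarrow> restrict X {s..t} r = circle_proj (f r)" "f t = x"
      using H1_path_lift by blast
    have Xf: "X r = circle_proj (f r)" if "r \<in> {s..t}" for r using f(2)[OF that] that by simp
    have eq: "f r = lift_from_end t x X r" if "r \<in> {s..t}" for r
      using lift_from_end_eq[of s t f X, OF f(1) Xf that] f(3) by simp
    show ?thesis
      using H1_on_cong[of s t f, OF f(1) eq] eq Xf f(3) that by auto
  qed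
  show "lift_from_end t x X t = x" using key[of "t - 1"] by simp
  show "H1_on s t (lift_from_end t x X)" if "s < t" for s using key[OF that] by simp
  show "X r = circle_proj (lift_from_end t x X r)" if "r \<le> t" for r
    using key[of "r - 1"] that by auto
qed

context point_potential
begin

lemma action_eq_lift_action:
  assumes f: "H1_on s t f" and X: "\<And>r. r \<in> {s..t} \<Longrightarrow> X r = circle_proj (f r)"
  shows "action \<mu> \<theta> s t X = lift_action \<theta> s t f"
proof -
  have ae: "AE r in lebesgue. r \<in> {s..t} \<longrightarrow> (deriv f r - \<theta>)\<^sup>2 = (circle_deriv X r - \<theta>)\<^sup>2"
    using AE_circle_deriv[of s t f X, OF f X] by (auto elim: eventually_mono)
  have "(LINT r:{s..t}|lebesgue. (deriv f r - \<theta>)\<^sup>2) = (LINT r:{s..t}|lebesgue. (circle_deriv X r - \<theta>)\<^sup>2)"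
    by (rule set_lebesgue_integral_lebesgue_cong_AE(2)[OF _ H1_on_tilted_square_integrable[OF f] ae]) simp
  moreover have "(\<lambda>r. (r, X r)) ` {s..<t} = (\<lambda>r. (r, circle_proj (f r))) ` {s..<t}"
    using X by (intro image_cong) auto
  ultimately show ?thesis
    by (simp add: action_def lift_action_def energy_def measure_graph H1_on_continuous_on[OF f])
qed

lemma minimizers_iff_lift_minimizer:
  assumes "s < t" and f: "H1_on s t f" and X: "\<And>r. r \<in> {s..t} \<Longrightarrow> X r = circle_proj (f r)"
  shows "restrict X {s..t} \<in> minimizers \<mu> \<theta> s (X s) t (X t) \<longleftrightarrow> lift_minimizer \<theta> s t f"
proof -
  let ?X = "restrict X {s..t}"
  have X': "?X r = circle_proj (f r)" if "r \<in> {s..t}" for r using X that by simp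
  have path: "?X \<in> H1_paths s t" using f X' by (auto simp: H1_paths_def)
  have A: "action \<mu> \<theta> s t ?X = lift_action \<theta> s t f"
    by (rule action_eq_lift_action[OF f]) (rule X')
  show ?thesis
  proof
    assume min: "?X \<in> minimizers \<mu> \<theta> s (X s) t (X t)"
    show "lift_minimizer \<theta> s t f"
      unfolding lift_minimizer_def
    proof (intro conjI f allI impI)
      fix g assume g: "H1_on s t g" "circle_proj (g s) = circle_proj (f s)" "circle_proj (g t) = circle_proj (f t)"
      define Z where "Z = restrict (\<lambda>r. circle_proj (g r)) {s..t}"
      have Z: "Z r = circle_proj (g r)" if "r \<in> {s..t}" for r using that by (simp add: Z_def)
      have "Z \<in> H1_paths s t" using g(1) Z by (auto simp: H1_paths_def Z_def)
      moreover have "Z s = X s" "Z t = X t" using X[of s] X[of t] Z[of s] Z[of t] g \<open>s < t\<close> by auto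
      ultimately have "action \<mu> \<theta> s t ?X \<le> action \<mu> \<theta> s t Z"
        using min by (simp add: minimizers_def)
      then show "lift_action \<theta> s t f \<le> lift_action \<theta> s t g"
        using action_eq_lift_action[of s t g Z \<theta>, OF g(1) Z] A by simp
    qed
  next
    assume min: "lift_minimizer \<theta> s t f"
    have "action \<mu> \<theta> s t ?X \<le> action \<mu> \<theta> s t Z"
      if Z: "Z \<in> H1_paths s t" "Z s = X s" "Z t = X t" for Z
    proof -
      obtain g where g: "H1_on s t g" "\<And>r. r \<in> {s..t} \<Longrightarrow> Z r = circle_proj (g r)"
        using Z(1) by (auto simp: H1_paths_def)
      have "lift_action \<theta> s t f \<le> lift_action \<theta> s t g"
        using X[of s] X[of t] g(2)[of s] g(2)[of t] Z \<open>s < t\<close>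
        by (intro lift_minimizerD[OF min g(1)]) auto
      then show ?thesis using action_eq_lift_action[of s t g Z \<theta>, OF g] A by simp
    qed
    then show "?X \<in> minimizers \<mu> \<theta> s (X s) t (X t)"
      using path \<open>s < t\<close> by (simp add: minimizers_def)
  qed
qed

definition one_sided_lift :: "real \<Rightarrow> real \<Rightarrow> (real \<Rightarrow> real) \<Rightarrow> bool"
  where "one_sided_lift \<theta> t f \<longleftrightarrow> (\<forall>s<t. lift_minimizer \<theta> s t f)"

lemma one_sided_lift_of_minimizer:
  assumes "X \<in> one_sided_minimizers_at \<mu> \<theta> t (circle_proj x)"
  shows "one_sided_lift \<theta> t (lift_from_end t x X)" "lift_from_end t x X t = x"
    "X \<in> extensional {..t}" "\<And>r. r \<le> t \<Longrightarrow> X r = circle_proj (lift_from_end t x X r)"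
proof -
  have X: "X \<in> H1_loc_paths t" "X t = circle_proj x"
    and min: "\<And>s. s < t \<Longrightarrow> restrict X {s..t} \<in> minimizers \<mu> \<theta> s (X s) t (X t)"
    using assms by (auto simp: one_sided_minimizers_at_def one_sided_minimizers_def)
  note L = lift_of_H1_loc_path[OF X]
  show "lift_from_end t x X t = x" by (rule L(1))
  show "X \<in> extensional {..t}" using X(1) by (simp add: H1_loc_paths_def)
  show XL: "X r = circle_proj (lift_from_end t x X r)" if "r \<le> t" for r using L(3)[OF that] .
  show "one_sided_lift \<theta> t (lift_from_end t x X)"
    unfolding one_sided_lift_def
  proof (intro allI impI)
    fix s assume "s < t"
    show "lift_minimizer \<theta> s t (lift_from_end t x X)"
      using minimizers_iff_lift_minimizer[OF \<open>s < t\<close> L(2)[OF \<open>s < t\<close>], of X \<theta>] min[OF \<open>s < t\<close>] XL by simp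
  qed
qed

lemma minimizer_of_one_sided_lift:
  assumes f: "one_sided_lift \<theta> t f"
  defines "X \<equiv> restrict (\<lambda>r. circle_proj (f r)) {..t}"
  shows "X \<in> one_sided_minimizers_at \<mu> \<theta> t (circle_proj (f t))"
    and "\<And>r. r \<le> t \<Longrightarrow> lift_from_end t (f t) X r = f r"
proof -
  have f': "lift_minimizer \<theta> s t f" if "s < t" for s using f that by (simp add: one_sided_lift_def)
  note H = lift_minimizer_H1[OF f']
  have X: "X r = circle_proj (f r)" if "r \<le> t" for r using that by (simp add: X_def)
  have "restrict X {s..t} \<in> H1_paths s t" if "s < t" for s
    using H[OF that] X unfolding H1_paths_def by auto
  then have "X \<in> H1_loc_paths t" by (simp add: H1_loc_paths_def X_def)
  moreover have "restrict X {s..t} \<in> minimizers \<mu> \<theta> s (X s) t (X t)" if "s < t" for s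
    using minimizers_iff_lift_minimizer[OF that H[OF that], of X \<theta>] X f'[OF that] by simp
  ultimately show "X \<in> one_sided_minimizers_at \<mu> \<theta> t (circle_proj (f t))"
    by (simp add: one_sided_minimizers_at_def one_sided_minimizers_def X_def)
  show "lift_from_end t (f t) X r = f r" if "r \<le> t" for r
    using lift_from_end_eq[OF H[of "r - 1"], of X r] X that by simp
qed

end

section \<open>One-sided minimizers\<close>

text \<open>The atoms of \<open>lift_minimizer_meets_atom\<close>, one of them before each time \<open>t\<close>, at \<open>(S t, y t)\<close>.\<close>

locale regenerating_potential = point_potential +
  fixes M :: real and S :: "real \<Rightarrow> real" and y :: "real \<Rightarrow> circle"
  assumes M_pos: "0 < M"
    and S_le: "\<And>t. S t \<le> t - M"
    and isolated: "\<And>t. supp \<mu> \<inter> ({S t - M..S t + M} \<times> UNIV) = {(S t, y t)}"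
    and heavy: "\<And>t. measure \<mu> {(S t, y t)} > 1 / (4 * M)"
begin

text \<open>Successive regeneration times, going backwards from \<open>t\<close>. The atom at time \<open>knot t (Suc k)\<close> has
  position \<open>y (knot t k)\<close>.\<close>

definition knot :: "real \<Rightarrow> nat \<Rightarrow> real"
  where "knot t k = (S ^^ k) t"

lemma knot_0 [simp]: "knot t 0 = t" and knot_Suc: "knot t (Suc k) = S (knot t k)"
  by (simp_all add: knot_def)

lemma knot_Suc_le: "knot t (Suc k) \<le> knot t k - M"
  by (simp add: knot_Suc S_le)

lemma knot_le: "knot t k \<le> t - real k * M"
proof (induction k)
  case (Suc k)
  then show ?case using knot_Suc_le[of t k] by (simp add: algebra_simps)
qed simp

lemma knot_Suc_less: "knot t (Suc k) < t"
proof -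
  have "0 < real (Suc k) * M" using M_pos by simp
  then show ?thesis using knot_le[of t "Suc k"] by linarith
qed

lemma knot_below: "\<exists>k. knot t (Suc k) \<le> r"
proof -
  obtain k where "t - r \<le> real k * M" using M_pos reals_Archimedean3 less_imp_le by blast
  then have "knot t (Suc k) \<le> r" using knot_le[of t k] knot_Suc_le[of t k] M_pos by linarith
  then show ?thesis ..
qed

text \<open>The window around \<open>knot t (Suc k)\<close> ends at or before \<open>knot t k \<le> t\<close>, and it starts no earlier than
  \<open>knot t (Suc (Suc k))\<close>.\<close>

lemma meets_knot:
  assumes f: "lift_minimizer \<theta> s t f" and s: "s \<le> knot t (Suc (Suc k))"
  shows "circle_proj (f (knot t (Suc k))) = y (knot t k)"
  unfolding knot_Suc
proof (rule lift_minimizer_meets_atom[OF f _ _ M_pos isolated heavy])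
  show "s \<le> S (knot t k) - M" using s knot_Suc_le[of t "Suc k"] by (simp add: knot_Suc)
  have "0 \<le> real k * M" using M_pos by simp
  then show "S (knot t k) + M \<le> t" using S_le[of "knot t k"] knot_le[of t k] by linarith
qed

lemma one_sided_lift_meets_knot:
  assumes "one_sided_lift \<theta> t f"
  shows "circle_proj (f (knot t (Suc k))) = y (knot t k)"
  using assms knot_Suc_less[of t "Suc k"] meets_knot order_refl by (auto simp: one_sided_lift_def)

text \<open>Let \<open>G k\<close> be the extremal minimizer from the atom at \<open>knot t (Suc k)\<close> to \<open>(t, x)\<close>. Then \<open>G (Suc k)\<close>
  extends \<open>G k\<close>. Indeed, \<open>G (Suc k)\<close> visits that atom, so extremality of \<open>G k\<close> gives one inequality.
  Conversely, \<open>G k\<close> continued backwards by an integer translate of \<open>G (Suc k)\<close> is a minimizer, so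
  extremality of \<open>G (Suc k)\<close> gives the other one. The common extension \<open>L\<close> is a minimizer on every
  interval, and it is extremal because every one-sided minimizer visits all the atoms.\<close>

lemma exists_extremal_one_sided_lift:
  assumes "\<epsilon> \<noteq> 0"
  obtains L where "one_sided_lift \<theta> t L" "L t = x"
    "\<And>f r. one_sided_lift \<theta> t f \<Longrightarrow> f t = x \<Longrightarrow> r \<le> t \<Longrightarrow> \<epsilon> * L r \<le> \<epsilon> * f r"
proof -
  let ?K = "\<lambda>k. knot t (Suc k)"
  have "\<exists>G. \<forall>k. lift_minimizer \<theta> (?K k) t (G k) \<and> G k t = x \<and> circle_proj (G k (?K k)) = y (knot t k) \<and>
      (\<forall>g. lift_minimizer \<theta> (?K k) t g \<longrightarrow> g t = x \<longrightarrow> circle_proj (g (?K k)) = y (knot t k) \<longrightarrow>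
        (\<forall>r\<in>{?K k..t}. \<epsilon> * G k r \<le> \<epsilon> * g r))"
    by (intro choice allI exists_extremal_lift_minimizer knot_Suc_less assms)
  then obtain G where min: "\<And>k. lift_minimizer \<theta> (?K k) t (G k)" and Gt: "\<And>k. G k t = x"
    and GK: "\<And>k. circle_proj (G k (?K k)) = y (knot t k)"
    and ext: "\<And>k g r. lift_minimizer \<theta> (?K k) t g \<Longrightarrow> g t = x \<Longrightarrow>
      circle_proj (g (?K k)) = y (knot t k) \<Longrightarrow> ?K k \<le> r \<Longrightarrow> r \<le> t \<Longrightarrow> \<epsilon> * G k r \<le> \<epsilon> * g r"
    by (metis atLeastAtMost_iff)
  have step: "G (Suc k) r = G k r" if r: "?K k \<le> r" "r \<le> t" for k r
  proof -
    define b where "b = ?K k"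
    define s where "s = ?K (Suc k)"
    have sb: "s \<le> b" "b \<le> t"
      using knot_Suc_le[of t "Suc k"] knot_Suc_less[of t k] M_pos by (simp_all add: s_def b_def)
    note mS = min[of "Suc k", folded s_def] and mk = min[of k, folded b_def]
    have Sb: "circle_proj (G (Suc k) b) = y (knot t k)"
      using meets_knot[OF mS] by (simp add: s_def b_def)
    have "\<epsilon> * G k r \<le> \<epsilon> * G (Suc k) r"
      using r Sb lift_minimizer_suffix[OF mS sb] by (intro ext) (auto simp: Gt b_def)
    moreover have "\<epsilon> * G (Suc k) r \<le> \<epsilon> * G k r"
    proof -
      define n where "n = G k b - G (Suc k) b"
      have n: "n \<in> \<int>" using Sb GK[of k] by (simp add: n_def b_def flip: circle_proj_eq_iff)
      let ?g = "\<lambda>r. G (Suc k) r + n"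
      have meet: "?g b = G k b" by (simp add: n_def)
      note j = join_right[where f = ?g and g = "G k", OF meet]
      note HS = lift_minimizer_H1[OF mS] and Hk = lift_minimizer_H1[OF mk]
      have Hg: "H1_on s b ?g"
        using sb by (intro H1_on_add_const H1_on_subinterval[OF HS]) auto
      have "lift_minimizer \<theta> s t (join b ?g (G k))"
      proof (rule lift_minimizer_le[OF mS])
        show "H1_on s t (join b ?g (G k))" by (rule H1_on_join[OF sb Hg Hk meet])
        show "circle_proj (join b ?g (G k) s) = circle_proj (G (Suc k) s)"
          using sb n by (simp add: circle_proj_add_Int)
        show "circle_proj (join b ?g (G k) t) = circle_proj (G (Suc k) t)"
          using sb by (simp add: j Gt)
        have "lift_action \<theta> b t (G k) \<le> lift_action \<theta> b t (G (Suc k))"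
          using sb Sb GK[of k]
          by (intro lift_minimizerD[OF mk] H1_on_subinterval[OF HS]) (auto simp: b_def Gt)
        then show "lift_action \<theta> s t (join b ?g (G k)) \<le> lift_action \<theta> s t (G (Suc k))"
          by (simp add: lift_action_join[OF sb Hg Hk meet] lift_action_split[OF HS sb]
              lift_action_add_Int[OF n])
      qed
      then have "\<epsilon> * G (Suc k) r \<le> \<epsilon> * join b ?g (G k) r"
        unfolding s_def
      proof (rule ext)
        show "join b ?g (G k) t = x" using sb by (simp add: j Gt)
        show "circle_proj (join b ?g (G k) (?K (Suc k))) = y (knot t (Suc k))"
          using sb n GK[of "Suc k"] by (simp add: circle_proj_add_Int s_def)
        show "?K (Suc k) \<le> r" "r \<le> t" using r sb by (auto simp: s_def b_def)
      qed
      then show ?thesis using r j[of r] by (simp add: b_def)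
    qed
    ultimately show ?thesis using assms by simp
  qed
  have mono: "?K (Suc k) \<le> ?K k" for k using knot_Suc_le[of t "Suc k"] M_pos by linarith
  define L where "L = (\<lambda>r. G (LEAST k. ?K k \<le> r) r)"
  have L: "L r = G k r" if "?K k \<le> r" "r \<le> t" for k r
  proof -
    define m where "m = (LEAST k. ?K k \<le> r)"
    have m: "?K m \<le> r" unfolding m_def by (rule LeastI[where P = "\<lambda>k. ?K k \<le> r", OF that(1)])
    have "m \<le> k" unfolding m_def by (rule Least_le) (rule that(1))
    then have "G k r = G m r \<and> ?K k \<le> r"
    proof (induction rule: dec_induct)
      case (step k)
      then show ?case using \<open>\<And>k r. ?K k \<le> r \<Longrightarrow> r \<le> t \<Longrightarrow> G (Suc k) r = G k r\<close> mono[of k] that(2) by force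
    qed (simp add: m)
    then show ?thesis by (simp add: L_def m_def)
  qed
  show thesis
  proof (rule that)
    show "one_sided_lift \<theta> t L"
      unfolding one_sided_lift_def
    proof (intro allI impI)
      fix s assume "s < t"
      obtain k where k: "?K k \<le> s" using knot_below by blast
      have "lift_minimizer \<theta> s t (G k)"
        using k \<open>s < t\<close> by (intro lift_minimizer_suffix[OF min]) auto
      then show "lift_minimizer \<theta> s t L"
      proof (rule lift_minimizer_cong)
        fix r assume "r \<in> {s..t}"
        then show "G k r = L r" using L[of k r] k by simp
      qed (use \<open>s < t\<close> in simp)
    qed
    show "L t = x" using L[of 0 t] knot_Suc_less[of t 0] Gt by simp
    fix f r assume f: "one_sided_lift \<theta> t f" "f t = x" and r: "r \<le> t"
    obtain k where k: "?K k \<le> r" using knot_below by blast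
    have "lift_minimizer \<theta> (?K k) t f" using f(1) knot_Suc_less by (simp add: one_sided_lift_def)
    then show "\<epsilon> * L r \<le> \<epsilon> * f r"
      unfolding L[OF k r] using f k r one_sided_lift_meets_knot[OF f(1)] by (intro ext) auto
  qed
qed

text \<open>The breakpoints are all the times at which the path visits an atom. They are locally finite, and
  unbounded below since they include the regeneration times; so each has a predecessor, and iterating
  the predecessor from \<open>t\<close> runs through all of them.\<close>

lemma one_sided_minimizer_piecewise_linear:
  assumes "X \<in> one_sided_minimizers_at \<mu> \<theta> t x"
  shows "piecewise_linear_through (supp \<mu>) t X"
proof -
  obtain x' where x': "x = circle_proj x'" by (rule circle_proj_surj)
  define f where "f = lift_from_end t x' X"
  note L = one_sided_lift_of_minimizer[OF assms[unfolded x'], folded f_def]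
  define H where "H = {r. r < t \<and> (r, X r) \<in> supp \<mu>}"
  have finH: "finite (H \<inter> {b..})" for b
  proof (rule finite_subset)
    show "H \<inter> {b..} \<subseteq> fst ` (supp \<mu> \<inter> ({b..t} \<times> UNIV))"
      by (auto simp: H_def intro!: rev_image_eqI)
  qed (simp add: finite_supp_strip)
  have knot_H: "knot t (Suc k) \<in> H" for k
  proof -
    have "(knot t (Suc k), y (knot t k)) \<in> supp \<mu>"
      using isolated[of "knot t k"] by (auto simp: knot_Suc)
    then show ?thesis
      using one_sided_lift_meets_knot[OF L(1)] L(4) knot_Suc_less[of t k] by (simp add: H_def)
  qed
  \<comment> \<open>A regeneration time below \<open>u\<close> makes the maximum range over a nonempty finite set.\<close>
  have "\<exists>v. v \<in> H \<and> v < u \<and> (\<forall>r\<in>H. r < u \<longrightarrow> r \<le> v)" for u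
  proof -
    obtain k where k: "knot t (Suc k) \<le> u - 1" using knot_below by blast
    define A where "A = {r \<in> H \<inter> {knot t (Suc k)..}. r < u}"
    have "A \<subseteq> H \<inter> {knot t (Suc k)..}" by (auto simp: A_def)
    then have A: "finite A" "knot t (Suc k) \<in> A"
      using finH finite_subset knot_H k by (blast, simp add: A_def)
    have "Max A \<in> A" using A by (intro Max_in) auto
    moreover have "r \<le> Max A" if "r \<in> H" "r < u" for r
    proof (cases "knot t (Suc k) \<le> r")
      case True
      then show ?thesis using that A by (intro Max_ge) (auto simp: A_def)
    next
      case False
      then show ?thesis using Max_ge[OF A] by linarith
    qed
    ultimately show ?thesis by (intro exI[of _ "Max A"]) (auto simp: A_def)
  qed
  then obtain prev where prev: "\<And>u. prev u \<in> H" "\<And>u. prev u < u" "\<And>u r. r \<in> H \<Longrightarrow> r < u \<Longrightarrow> r \<le> prev u"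
    by metis
  define \<tau> where "\<tau> n = (prev ^^ n) t" for n
  have \<tau>: "\<tau> 0 = t" "\<tau> (Suc n) = prev (\<tau> n)" for n by (simp_all add: \<tau>_def)
  have dec: "\<tau> (Suc n) < \<tau> n" for n by (simp add: \<tau> prev)
  then have "decseq \<tau>" by (intro decseq_SucI less_imp_le)
  have "inj \<tau>"
  proof (rule linorder_injI)
    fix m n :: nat assume "m < n"
    then have "\<tau> n \<le> \<tau> (Suc m)" using decseqD[OF \<open>decseq \<tau>\<close>, of "Suc m" n] by simp
    then show "\<tau> m \<noteq> \<tau> n" using dec[of m] by simp
  qed
  have le_t: "\<tau> n \<le> t" for n using decseqD[OF \<open>decseq \<tau>\<close>, of 0 n] by (simp add: \<tau>)
  have "filterlim \<tau> at_bot sequentially"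
    unfolding filterlim_at_bot
  proof
    fix Z
    have "\<exists>n. \<tau> n \<le> Z"
    proof (rule ccontr)
      assume "\<nexists>n. \<tau> n \<le> Z"
      then have "Z \<le> \<tau> (Suc n)" for n by (meson linear)
      moreover have "\<tau> (Suc n) \<in> H" for n unfolding \<tau>(2) by (rule prev(1))
      ultimately have "range (\<lambda>n. \<tau> (Suc n)) \<subseteq> H \<inter> {Z..}" by blast
      then have "finite (range (\<lambda>n. \<tau> (Suc n)))" using finH finite_subset by blast
      moreover have "inj (\<lambda>n. \<tau> (Suc n))" using \<open>inj \<tau>\<close> by (auto simp: inj_def)
      ultimately show False using finite_imageD infinite_UNIV_nat by blast
    qed
    then obtain n where "\<tau> n \<le> Z" by blast
    then show "\<forall>\<^sub>F n in sequentially. \<tau> n \<le> Z"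
      unfolding eventually_sequentially using decseqD[OF \<open>decseq \<tau>\<close>] by (meson order_trans)
  qed
  moreover have "(\<tau> (Suc n), X (\<tau> (Suc n))) \<in> supp \<mu>" for n
    using prev(1) by (simp add: \<tau> H_def)
  moreover have "\<exists>a v. \<forall>r\<in>{\<tau> (Suc n)..\<tau> n}. X r = circle_proj (a + v * r)" for n
  proof -
    let ?a = "\<tau> (Suc n)" and ?b = "\<tau> n"
    have "?a < t" using dec[of n] le_t[of n] by simp
    then have "straight ?a t f"
      using L(1) by (intro lift_minimizer_straight[where \<theta> = \<theta>]) (simp add: one_sided_lift_def)
    moreover have "(r, circle_proj (f r)) \<notin> supp \<mu>" if "?a < r" "r < ?b" for r
      using prev(3)[of r ?b] that le_t[of n] L(4)[of r] by (auto simp: H_def \<tau>)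
    ultimately have chord: "f r = chord ?a ?b f r" if "r \<in> {?a..?b}" for r
      using that dec le_t by (intro straightD[of ?a t f]) (auto intro: less_imp_le)
    show ?thesis
    proof (intro exI ballI)
      fix r assume r: "r \<in> {?a..?b}"
      then have "X r = circle_proj (f r)" using le_t[of n] by (intro L(4)) auto
      also have "f r = (f ?a - (f ?b - f ?a) / (?b - ?a) * ?a) + (f ?b - f ?a) / (?b - ?a) * r"
        using chord[OF r] unfolding chord_affine .
      finally show "X r = circle_proj ((f ?a - (f ?b - f ?a) / (?b - ?a) * ?a) + (f ?b - f ?a) / (?b - ?a) * r)" .
    qed
  qed
  ultimately show ?thesis
    unfolding piecewise_linear_through_def using dec \<tau>(1) by blast
qed

lemma exists_extremal_one_sided_minimizer:
  assumes "\<epsilon> \<noteq> 0"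
  obtains X where "X \<in> one_sided_minimizers_at \<mu> \<theta> t (circle_proj x)"
    "\<And>Y r. Y \<in> one_sided_minimizers_at \<mu> \<theta> t (circle_proj x) \<Longrightarrow> r \<le> t \<Longrightarrow>
      \<epsilon> * lift_from_end t x X r \<le> \<epsilon> * lift_from_end t x Y r"
proof -
  obtain L where L: "one_sided_lift \<theta> t L" "L t = x"
    "\<And>f r. one_sided_lift \<theta> t f \<Longrightarrow> f t = x \<Longrightarrow> r \<le> t \<Longrightarrow> \<epsilon> * L r \<le> \<epsilon> * f r"
    using exists_extremal_one_sided_lift[OF assms] by blast
  note X = minimizer_of_one_sided_lift[OF L(1), unfolded L(2)]
  show thesis
    using X L(3) one_sided_lift_of_minimizer by (intro that[OF X(1)]) auto
qed

lemma path_le_antisym: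
  assumes X: "X \<in> one_sided_minimizers_at \<mu> \<theta> t x" and Y: "Y \<in> one_sided_minimizers_at \<mu> \<theta> t x"
    and le: "path_le t X Y" "path_le t Y X"
  shows "X = Y"
proof -
  obtain x' where x': "x = circle_proj x'" by (rule circle_proj_surj)
  note LX = one_sided_lift_of_minimizer[OF X[unfolded x']] and LY = one_sided_lift_of_minimizer[OF Y[unfolded x']]
  show ?thesis
  proof (rule extensionalityI[OF LX(3) LY(3)])
    fix r assume "r \<in> {..t}"
    then have "lift_from_end t x' X r = lift_from_end t x' Y r"
      using le unfolding path_le_iff_lift_le[where x = x'] by (intro antisym) auto
    then show "X r = Y r" using LX(4)[of r] LY(4)[of r] \<open>r \<in> {..t}\<close> by simp
  qed
qed

lemma exists_least_one_sided_minimizer: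
  "\<exists>X\<in>one_sided_minimizers_at \<mu> \<theta> t x. \<forall>Y\<in>one_sided_minimizers_at \<mu> \<theta> t x. path_le t X Y"
proof -
  obtain x' where x': "x = circle_proj x'" by (rule circle_proj_surj)
  obtain X where "X \<in> one_sided_minimizers_at \<mu> \<theta> t (circle_proj x')"
    "\<And>Y r. Y \<in> one_sided_minimizers_at \<mu> \<theta> t (circle_proj x') \<Longrightarrow> r \<le> t \<Longrightarrow>
      1 * lift_from_end t x' X r \<le> 1 * lift_from_end t x' Y r"
    using exists_extremal_one_sided_minimizer[of 1 \<theta> t x', OF one_neq_zero] by blast
  then show ?thesis
    unfolding x' path_le_iff_lift_le[where x = x'] by (intro bexI[of _ X]) auto
qed

lemma exists_greatest_one_sided_minimizer:
  "\<exists>X\<in>one_sided_minimizers_at \<mu> \<theta> t x. \<forall>Y\<in>one_sided_minimizers_at \<mu> \<theta> t x. path_le t Y X"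
proof -
  obtain x' where x': "x = circle_proj x'" by (rule circle_proj_surj)
  obtain X where "X \<in> one_sided_minimizers_at \<mu> \<theta> t (circle_proj x')"
    "\<And>Y r. Y \<in> one_sided_minimizers_at \<mu> \<theta> t (circle_proj x') \<Longrightarrow> r \<le> t \<Longrightarrow>
      - 1 * lift_from_end t x' X r \<le> - 1 * lift_from_end t x' Y r"
    using exists_extremal_one_sided_minimizer[of "- 1" \<theta> t x'] by (metis zero_neq_neg_one)
  then show ?thesis
    unfolding x' path_le_iff_lift_le[where x = x'] by (intro bexI[of _ X]) auto
qed

end

theorem theorem1p4:
  fixes \<mu> :: "(real \<times> circle) measure" and \<theta> t :: real and x :: circle
  assumes "\<mu> \<in> Omega_tilde1"
  shows "one_sided_minimizers_at \<mu> \<theta> t x \<noteq> {} \<and>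
    (\<forall>X\<in>one_sided_minimizers_at \<mu> \<theta> t x. piecewise_linear_through (supp \<mu>) t X) \<and>
    (\<exists>!X. X \<in> one_sided_minimizers_at \<mu> \<theta> t x \<and>
      (\<forall>Y\<in>one_sided_minimizers_at \<mu> \<theta> t x. path_le t Y X \<longrightarrow> Y = X)) \<and>
    (\<exists>!X. X \<in> one_sided_minimizers_at \<mu> \<theta> t x \<and>
      (\<forall>Y\<in>one_sided_minimizers_at \<mu> \<theta> t x. path_le t X Y \<longrightarrow> Y = X))"
proof -
  obtain M S y where "\<mu> \<in> Omega" "0 < M" and
      "\<And>t. S t \<le> t - M \<and> supp \<mu> \<inter> ({S t - M..S t + M} \<times> UNIV) = {(S t, y t)} \<and>
        measure \<mu> {(S t, y t)} > 1 / (4 * M)"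
    using assms unfolding Omega_tilde1_def by blast
  then have "regenerating_potential \<mu> M S y"
    by unfold_locales blast+
  then interpret regenerating_potential \<mu> M S y .
  let ?M = "one_sided_minimizers_at \<mu> \<theta> t x"
  obtain X\<^sub>L where XL: "X\<^sub>L \<in> ?M" "\<And>Y. Y \<in> ?M \<Longrightarrow> path_le t X\<^sub>L Y"
    using exists_least_one_sided_minimizer by blast
  obtain X\<^sub>R where XR: "X\<^sub>R \<in> ?M" "\<And>Y. Y \<in> ?M \<Longrightarrow> path_le t Y X\<^sub>R"
    using exists_greatest_one_sided_minimizer by blast
  have "\<exists>!X. X \<in> ?M \<and> (\<forall>Y\<in>?M. path_le t Y X \<longrightarrow> Y = X)"
    by (rule ex1I[of _ X\<^sub>L]) (use XL path_le_antisym in blast)+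
  moreover have "\<exists>!X. X \<in> ?M \<and> (\<forall>Y\<in>?M. path_le t X Y \<longrightarrow> Y = X)"
    by (rule ex1I[of _ X\<^sub>R]) (use XR path_le_antisym in blast)+
  ultimately show ?thesis using XL(1) one_sided_minimizer_piecewise_linear by blast
qed

end
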